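(* Let $\gamma_1$ and $\gamma_2$ be regular closed curves on a surface $M$ with a tame conformally euclidean structure $\widetilde M\subset\mathbb E^2$. Suppose they have the same base point $p$ and the same base direction. Fix a point $\widetilde p\in\widetilde M$ over $p$ and let $\widetilde\gamma_1$ and $\widetilde\gamma_2$ be the lifts of $\gamma_1$ and $\gamma_2$ with initial point $\widetilde p$. Then the following are equivalent. (1) $\gamma_1$ and $\gamma_2$ are regularly homotopic fixing the base point and the base direction. (2) $[\gamma_1]=[\gamma_2]\in\pi_1(M,p)$ and $i_{\widetilde\gamma_1}=i_{\widetilde\gamma_2}$.
   Context: Surfaces are connected, smooth and without boundary; $\mathbb E^2$ is the euclidean plane. For a riemannian surface $M$, $\widetilde M\to M$ is the universal cover, with the riemannian metric induced from $M$. A conformally euclidean structure on $M$ is a conformal embedding $\widetilde M\subset\mathbb E^2$ (conformal: preserving non-oriented angles at each point); $\widetilde M$ is regarded as a subset of $\mathbb E^2$. It is tame if (1) any two points of $\widetilde M$ can be joined by a unique shortest geodesic in $\widetilde M$ (for the metric induced from $M$), and (2) for any compact subset $K$ of the interior of $\widetilde M$ there is a regular map $f:\mathbb E^2\to\widetilde M$ (smooth with everywhere invertible differential) with $f|_K=\mathrm{id}_K$. Curves are $C^1$ maps $\gamma:[a,b]\to M$ (or into $\mathbb E^2$), identified under orientation-preserving reparametrization. $\gamma$ is regular if its velocity $v_\gamma(u)$ never vanishes; then $e_\gamma(u)=v_\gamma(u)/|v_\gamma(u)|$. A regular closed curve on $M$ is a regular curve with $\gamma(a)=\gamma(b)$ (the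 base point) and $e_\gamma(a)=e_\gamma(b)$ (the base direction). A regular homotopy between regular closed curves is a homotopy $\{\sigma_t\}_{0\le t\le1}$ such that every $\sigma_t$ is a regular closed curve and $(t,u)\mapsto v_{\sigma_t}(u)$ is continuous. For a regular curve $\gamma:[a,b]\to\mathbb E^2$, an angle function is a continuous $\theta:[a,b]\to\mathbb R$ with $e_\gamma(u)=(\cos\theta(u),\sin\theta(u))$, and the $i$-index is $i_\gamma=\frac{\theta(b)-\theta(a)}{2\pi}\in\mathbb R$, which does not depend on the choice of $\theta$. Lifts to $\widetilde M$ are viewed as curves in $\mathbb E^2$. *)

theory Defs
  imports "HOL-Analysis.Analysis"
begin

text \<open>The euclidean plane is modelled by the type \<^typ>\<open>complex\<close> with its real inner product
  and norm; the unit vector \<open>(cos \<theta>, sin \<theta>)\<close> is \<^term>\<open>cis \<theta>\<close>.\<close>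

section \<open>Smooth maps\<close>

text \<open>Meant for open \<open>S\<close>: differentiability is at points of \<open>S\<close>, not within \<open>S\<close>.\<close>

primrec C_k_on ::
  "nat \<Rightarrow> ('a::real_normed_vector \<Rightarrow> 'b::real_normed_vector) \<Rightarrow> 'a set \<Rightarrow> bool" where
  "C_k_on 0 f S \<longleftrightarrow> continuous_on S f"
| "C_k_on (Suc k) f S \<longleftrightarrow>
     (\<forall>x\<in>S. f differentiable (at x)) \<and>
     (\<forall>v. C_k_on k (\<lambda>x. frechet_derivative f (at x) v) S)"

definition smooth_on ::
  "('a::real_normed_vector \<Rightarrow> 'b::real_normed_vector) \<Rightarrow> 'a set \<Rightarrow> bool" where
  "smooth_on f S \<longleftrightarrow> (\<forall>k. C_k_on k f S)"


section \<open>Riemannian surfaces\<close>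

text \<open>A chart is its domain together with its coordinate map (whose values outside the
  domain are irrelevant).\<close>

type_synonym 'm chart = "'m set \<times> ('m \<Rightarrow> complex)"

definition is_chart :: "'m::topological_space set \<Rightarrow> 'm chart \<Rightarrow> bool" where
  "is_chart M c \<longleftrightarrow>
     openin (top_of_set M) (fst c) \<and> open (snd c ` fst c) \<and>
     (\<exists>\<psi>. homeomorphism (fst c) (snd c ` fst c) (snd c) \<psi>)"

definition transition :: "'m chart \<Rightarrow> 'm chart \<Rightarrow> complex \<Rightarrow> complex" where
  "transition c d = snd d \<circ> inv_into (fst c) (snd c)"

locale smooth_surface =
  fixes M :: "'m::topological_space set" and A :: "'m chart set"
  assumes hausdorff: "Hausdorff_space (top_of_set M)"
    and second_countable: "second_countable (top_of_set M)"
    and connected: "connected M"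
    and chart: "\<And>c. c \<in> A \<Longrightarrow> is_chart M c"
    and cover: "(\<Union>c\<in>A. fst c) = M"
    and compatible: "\<And>c d. \<lbrakk>c \<in> A; d \<in> A\<rbrakk> \<Longrightarrow>
      smooth_on (transition c d) (snd c ` (fst c \<inter> fst d))"

text \<open>A riemannian metric is given by its coordinate expressions: \<open>g c x u v\<close> is the inner
  product, at the point with coordinate \<open>x\<close> in the chart \<open>c\<close>, of the two tangent vectors whose
  components in \<open>c\<close> are \<open>u\<close> and \<open>v\<close>.\<close>

type_synonym 'm metric_tensor = "'m chart \<Rightarrow> complex \<Rightarrow> complex \<Rightarrow> complex \<Rightarrow> real"

locale riemannian_surface = smooth_surface M A
  for M :: "'m::topological_space set" and A :: "'m chart set" +
  fixes g :: "'m metric_tensor"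
  assumes metric_bilinear: "\<And>c x. \<lbrakk>c \<in> A; x \<in> snd c ` fst c\<rbrakk> \<Longrightarrow> bilinear (g c x)"
    and metric_sym: "\<And>c x u v. \<lbrakk>c \<in> A; x \<in> snd c ` fst c\<rbrakk> \<Longrightarrow> g c x u v = g c x v u"
    and metric_pos: "\<And>c x u. \<lbrakk>c \<in> A; x \<in> snd c ` fst c; u \<noteq> 0\<rbrakk> \<Longrightarrow> g c x u u > 0"
    and metric_smooth: "\<And>c u v. c \<in> A \<Longrightarrow> smooth_on (\<lambda>x. g c x u v) (snd c ` fst c)"
    and metric_change: "\<And>c d x u v.
      \<lbrakk>c \<in> A; d \<in> A; x \<in> snd c ` (fst c \<inter> fst d)\<rbrakk> \<Longrightarrow>
      g d (transition c d x)
        (frechet_derivative (transition c d) (at x) u)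
        (frechet_derivative (transition c d) (at x) v) = g c x u v"

text \<open>A tangent vector at \<open>x\<close> is represented by the family of its components in all the charts
  around \<open>x\<close>, extended by \<^term>\<open>undefined\<close> to the other charts. So two tangent vectors at the
  same point are equal iff these families are equal, and a map into the tangent bundle is
  continuous iff its base point map is continuous and, for each chart, its component in that
  chart is continuous where it is defined.\<close>

type_synonym 'm tangent = "'m chart \<Rightarrow> complex"

definition charts_at :: "'m chart set \<Rightarrow> 'm \<Rightarrow> 'm chart set" where
  "charts_at A x = {c \<in> A. x \<in> fst c}"

text \<open>By the transformation law of the metric, the choice of the chart does not matter.\<close>

definition tangent_inner ::
  "'m chart set \<Rightarrow> 'm metric_tensor \<Rightarrow> 'm \<Rightarrow> 'm tangent \<Rightarrow> 'm tangent \<Rightarrow> real" where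
  "tangent_inner A g x \<xi> \<eta> =
     (let c = (SOME c. c \<in> charts_at A x) in g c (snd c x) (\<xi> c) (\<eta> c))"

definition tangent_norm :: "'m chart set \<Rightarrow> 'm metric_tensor \<Rightarrow> 'm \<Rightarrow> 'm tangent \<Rightarrow> real" where
  "tangent_norm A g x \<xi> = sqrt (tangent_inner A g x \<xi> \<xi>)"


section \<open>Curves on a surface\<close>

definition velocity :: "'m chart set \<Rightarrow> real \<Rightarrow> real \<Rightarrow> (real \<Rightarrow> 'm) \<Rightarrow> real \<Rightarrow> 'm tangent" where
  "velocity A a b \<gamma> u =
     (\<lambda>c\<in>charts_at A (\<gamma> u). vector_derivative (snd c \<circ> \<gamma>) (at u within {a..b}))"

definition C1_curve ::
  "'m::topological_space set \<Rightarrow> 'm chart set \<Rightarrow> real \<Rightarrow> real \<Rightarrow> (real \<Rightarrow> 'm) \<Rightarrow> bool" where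
  "C1_curve M A a b \<gamma> \<longleftrightarrow>
     a < b \<and> continuous_on {a..b} \<gamma> \<and> \<gamma> ` {a..b} \<subseteq> M \<and>
     (\<forall>c\<in>A.
        (\<forall>u\<in>{a..b}. \<gamma> u \<in> fst c \<longrightarrow> (snd c \<circ> \<gamma>) differentiable (at u within {a..b})) \<and>
        continuous_on {u\<in>{a..b}. \<gamma> u \<in> fst c} (\<lambda>u. velocity A a b \<gamma> u c))"

definition regular_curve ::
  "'m::topological_space set \<Rightarrow> 'm chart set \<Rightarrow> real \<Rightarrow> real \<Rightarrow> (real \<Rightarrow> 'm) \<Rightarrow> bool" where
  "regular_curve M A a b \<gamma> \<longleftrightarrow>
     C1_curve M A a b \<gamma> \<and>
     (\<forall>u\<in>{a..b}. \<forall>c\<in>charts_at A (\<gamma> u). velocity A a b \<gamma> u c \<noteq> 0)"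

definition direction ::
  "'m chart set \<Rightarrow> 'm metric_tensor \<Rightarrow> real \<Rightarrow> real \<Rightarrow> (real \<Rightarrow> 'm) \<Rightarrow> real \<Rightarrow> 'm tangent" where
  "direction A g a b \<gamma> u =
     (\<lambda>c\<in>charts_at A (\<gamma> u).
        velocity A a b \<gamma> u c /\<^sub>R tangent_norm A g (\<gamma> u) (velocity A a b \<gamma> u))"

definition regular_closed_curve ::
  "'m::topological_space set \<Rightarrow> 'm chart set \<Rightarrow> 'm metric_tensor \<Rightarrow>
     real \<Rightarrow> real \<Rightarrow> (real \<Rightarrow> 'm) \<Rightarrow> bool" where
  "regular_closed_curve M A g a b \<gamma> \<longleftrightarrow>
     regular_curve M A a b \<gamma> \<and> \<gamma> a = \<gamma> b \<and> direction A g a b \<gamma> a = direction A g a b \<gamma> b"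

text \<open>\<open>\<delta>\<close> on \<open>[c, d]\<close> is an orientation-preserving reparametrization of \<open>\<gamma>\<close> on \<open>[a, b]\<close>.\<close>

definition reparametrization ::
  "real \<Rightarrow> real \<Rightarrow> (real \<Rightarrow> 'm) \<Rightarrow> real \<Rightarrow> real \<Rightarrow> (real \<Rightarrow> 'm) \<Rightarrow> bool" where
  "reparametrization a b \<gamma> c d \<delta> \<longleftrightarrow>
     (\<exists>h h'. h c = a \<and> h d = b \<and> continuous_on {c..d} h' \<and>
        (\<forall>u\<in>{c..d}. (h has_real_derivative h' u) (at u within {c..d}) \<and> 0 < h' u \<and>
           \<delta> u = \<gamma> (h u)))"

definition regular_homotopy ::
  "'m::topological_space set \<Rightarrow> 'm chart set \<Rightarrow> 'm metric_tensor \<Rightarrow>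
     real \<Rightarrow> real \<Rightarrow> (real \<Rightarrow> real \<Rightarrow> 'm) \<Rightarrow> bool" where
  "regular_homotopy M A g a b \<sigma> \<longleftrightarrow>
     continuous_on ({0..1} \<times> {a..b}) (\<lambda>(t, u). \<sigma> t u) \<and>
     (\<forall>t\<in>{0..1}. regular_closed_curve M A g a b (\<sigma> t)) \<and>
     (\<forall>c\<in>A. continuous_on {(t, u). t \<in> {0..1} \<and> u \<in> {a..b} \<and> \<sigma> t u \<in> fst c}
        (\<lambda>(t, u). velocity A a b (\<sigma> t) u c))"

text \<open>Curves are identified under orientation-preserving reparametrization, so the ends of the
  homotopy are only required to be reparametrizations of the two given curves.\<close>

definition regularly_homotopic_fixing_base ::
  "'m::topological_space set \<Rightarrow> 'm chart set \<Rightarrow> 'm metric_tensor \<Rightarrow>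
     real \<Rightarrow> real \<Rightarrow> (real \<Rightarrow> 'm) \<Rightarrow> real \<Rightarrow> real \<Rightarrow> (real \<Rightarrow> 'm) \<Rightarrow> bool" where
  "regularly_homotopic_fixing_base M A g a\<^sub>1 b\<^sub>1 \<gamma>\<^sub>1 a\<^sub>2 b\<^sub>2 \<gamma>\<^sub>2 \<longleftrightarrow>
     (\<exists>a b \<sigma>. regular_homotopy M A g a b \<sigma> \<and>
        reparametrization a\<^sub>1 b\<^sub>1 \<gamma>\<^sub>1 a b (\<sigma> 0) \<and>
        reparametrization a\<^sub>2 b\<^sub>2 \<gamma>\<^sub>2 a b (\<sigma> 1) \<and>
        (\<forall>t\<in>{0..1}. \<sigma> t a = \<gamma>\<^sub>1 a\<^sub>1 \<and>
           direction A g a b (\<sigma> t) a = direction A g a\<^sub>1 b\<^sub>1 \<gamma>\<^sub>1 a\<^sub>1))"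

text \<open>Affine reparametrization to the unit interval, as used by \<^const>\<open>homotopic_paths\<close>.\<close>

definition unit_path :: "real \<Rightarrow> real \<Rightarrow> (real \<Rightarrow> 'm) \<Rightarrow> real \<Rightarrow> 'm" where
  "unit_path a b \<gamma> = (\<lambda>s. \<gamma> (a + s * (b - a)))"

definition is_lift ::
  "complex set \<Rightarrow> (complex \<Rightarrow> 'm) \<Rightarrow> real \<Rightarrow> real \<Rightarrow> (real \<Rightarrow> 'm) \<Rightarrow> (real \<Rightarrow> complex) \<Rightarrow> bool" where
  "is_lift W \<pi> a b \<gamma> \<gamma>' \<longleftrightarrow>
     continuous_on {a..b} \<gamma>' \<and> \<gamma>' ` {a..b} \<subseteq> W \<and> (\<forall>u\<in>{a..b}. \<pi> (\<gamma>' u) = \<gamma> u)"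


section \<open>Index of a regular curve in the plane\<close>

definition angle_function :: "real \<Rightarrow> real \<Rightarrow> (real \<Rightarrow> complex) \<Rightarrow> (real \<Rightarrow> real) \<Rightarrow> bool" where
  "angle_function a b \<gamma> \<theta> \<longleftrightarrow>
     continuous_on {a..b} \<theta> \<and>
     (\<forall>u\<in>{a..b}. vector_derivative \<gamma> (at u within {a..b})
          /\<^sub>R norm (vector_derivative \<gamma> (at u within {a..b})) = cis (\<theta> u))"

definition i_index :: "real \<Rightarrow> real \<Rightarrow> (real \<Rightarrow> complex) \<Rightarrow> real" where
  "i_index a b \<gamma> = (THE i. \<exists>\<theta>. angle_function a b \<gamma> \<theta> \<and> i = (\<theta> b - \<theta> a) / (2 * pi))"


section \<open>Conformally euclidean structures\<close>

text \<open>In this section \<open>G\<close> is a riemannian metric on an open subset \<open>W\<close> of the plane.\<close>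

definition metric_angle ::
  "(complex \<Rightarrow> complex \<Rightarrow> real) \<Rightarrow> complex \<Rightarrow> complex \<Rightarrow> real" where
  "metric_angle B u v = arccos (B u v / (sqrt (B u u) * sqrt (B v v)))"

text \<open>The geodesic equation \<open>\<nabla>\<^bsub>\<gamma>'\<^esub> \<gamma>' = 0\<close> of the Levi-Civita connection, paired with an
  arbitrary vector \<open>w\<close>. With Christoffel symbols of the first kind
  \<open>\<Gamma>\<^bsub>k,ij\<^esub> = (\<partial>\<^sub>i G\<^bsub>jk\<^esub> + \<partial>\<^sub>j G\<^bsub>ik\<^esub> - \<partial>\<^sub>k G\<^bsub>ij\<^esub>) / 2\<close>, the last two terms below are
  \<open>\<Gamma>\<^bsub>k,ij\<^esub> v\<^sup>i v\<^sup>j w\<^sup>k\<close>. Geodesics are parametrized proportionally to arc length by the unit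
  interval, which fixes a unique parametrization; constant geodesics are allowed.\<close>

definition geodesic ::
  "(complex \<Rightarrow> complex \<Rightarrow> complex \<Rightarrow> real) \<Rightarrow> complex set \<Rightarrow> (real \<Rightarrow> complex) \<Rightarrow> bool" where
  "geodesic G W \<gamma> \<longleftrightarrow>
     \<gamma> ` {0..1} \<subseteq> W \<and>
     (\<exists>v a. \<forall>t\<in>{0..1}.
        (\<gamma> has_vector_derivative v t) (at t within {0..1}) \<and>
        (v has_vector_derivative a t) (at t within {0..1}) \<and>
        (\<forall>w. G (\<gamma> t) (a t) w
           + frechet_derivative (\<lambda>x. G x (v t) w) (at (\<gamma> t)) (v t)
           - frechet_derivative (\<lambda>x. G x (v t) (v t)) (at (\<gamma> t)) w / 2 = 0))"

definition metric_length ::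
  "(complex \<Rightarrow> complex \<Rightarrow> complex \<Rightarrow> real) \<Rightarrow> (real \<Rightarrow> complex) \<Rightarrow> real" where
  "metric_length G \<gamma> =
     integral {0..1} (\<lambda>t. sqrt (G (\<gamma> t) (vector_derivative \<gamma> (at t within {0..1}))
                                     (vector_derivative \<gamma> (at t within {0..1}))))"

definition geodesic_between ::
  "(complex \<Rightarrow> complex \<Rightarrow> complex \<Rightarrow> real) \<Rightarrow> complex set \<Rightarrow> complex \<Rightarrow> complex \<Rightarrow>
     (real \<Rightarrow> complex) \<Rightarrow> bool" where
  "geodesic_between G W x y \<gamma> \<longleftrightarrow> geodesic G W \<gamma> \<and> \<gamma> 0 = x \<and> \<gamma> 1 = y"

text \<open>Shortest among the geodesics from \<open>x\<close> to \<open>y\<close>. If there is a unique geodesic which is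
  shortest even among all curves from \<open>x\<close> to \<open>y\<close>, then it is also the unique shortest geodesic
  in this sense; so tameness as defined below is, if anything, the more inclusive notion.\<close>

definition shortest_geodesic ::
  "(complex \<Rightarrow> complex \<Rightarrow> complex \<Rightarrow> real) \<Rightarrow> complex set \<Rightarrow> complex \<Rightarrow> complex \<Rightarrow>
     (real \<Rightarrow> complex) \<Rightarrow> bool" where
  "shortest_geodesic G W x y \<gamma> \<longleftrightarrow>
     geodesic_between G W x y \<gamma> \<and>
     (\<forall>\<delta>. geodesic_between G W x y \<delta> \<longrightarrow> metric_length G \<gamma> \<le> metric_length G \<delta>)"

definition differential ::
  "'m chart set \<Rightarrow> (complex \<Rightarrow> 'm) \<Rightarrow> complex \<Rightarrow> complex \<Rightarrow> 'm tangent" where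
  "differential A \<pi> w u =
     (\<lambda>c\<in>charts_at A (\<pi> w). frechet_derivative (snd c \<circ> \<pi>) (at w) u)"

definition pullback_metric ::
  "'m chart set \<Rightarrow> 'm metric_tensor \<Rightarrow> (complex \<Rightarrow> 'm) \<Rightarrow>
     complex \<Rightarrow> complex \<Rightarrow> complex \<Rightarrow> real" where
  "pullback_metric A g \<pi> w u v =
     tangent_inner A g (\<pi> w) (differential A \<pi> w u) (differential A \<pi> w v)"

definition local_diffeo :: "'m chart set \<Rightarrow> complex set \<Rightarrow> (complex \<Rightarrow> 'm) \<Rightarrow> bool" where
  "local_diffeo A W \<pi> \<longleftrightarrow>
     (\<forall>c\<in>A. smooth_on (snd c \<circ> \<pi>) (W \<inter> \<pi> -` fst c) \<and>
        (\<forall>w \<in> W \<inter> \<pi> -` fst c. bij (frechet_derivative (snd c \<circ> \<pi>) (at w))))"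

text \<open>The universal cover is regarded as a subset \<open>W\<close> of the plane, with covering projection \<open>\<pi>\<close>.
  As an embedded surface without boundary, \<open>W\<close> is open. The smooth structure induced from \<open>M\<close>
  agrees with that of the plane (the embedding is smooth), i.e. \<open>\<pi>\<close> is a local diffeomorphism.
  The inclusion preserves the non-oriented angles of the metric induced from \<open>M\<close>.\<close>

definition conformally_euclidean_structure ::
  "'m::topological_space set \<Rightarrow> 'm chart set \<Rightarrow> 'm metric_tensor \<Rightarrow>
     complex set \<Rightarrow> (complex \<Rightarrow> 'm) \<Rightarrow> bool" where
  "conformally_euclidean_structure M A g W \<pi> \<longleftrightarrow>
     open W \<and> simply_connected W \<and> covering_space W \<pi> M \<and> local_diffeo A W \<pi> \<and>
     (\<forall>w\<in>W. \<forall>u v. u \<noteq> 0 \<longrightarrow> v \<noteq> 0 \<longrightarrow>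
        metric_angle (pullback_metric A g \<pi> w) u v = metric_angle inner u v)"

definition tame ::
  "'m::topological_space set \<Rightarrow> 'm chart set \<Rightarrow> 'm metric_tensor \<Rightarrow>
     complex set \<Rightarrow> (complex \<Rightarrow> 'm) \<Rightarrow> bool" where
  "tame M A g W \<pi> \<longleftrightarrow>
     conformally_euclidean_structure M A g W \<pi> \<and>
     (\<forall>x\<in>W. \<forall>y\<in>W. \<exists>\<gamma>. shortest_geodesic (pullback_metric A g \<pi>) W x y \<gamma> \<and>
        (\<forall>\<delta>. shortest_geodesic (pullback_metric A g \<pi>) W x y \<delta> \<longrightarrow>
           (\<forall>t\<in>{0..1}. \<delta> t = \<gamma> t))) \<and>
     (\<forall>K. compact K \<and> K \<subseteq> interior W \<longrightarrow>
        (\<exists>f. smooth_on f UNIV \<and> f ` UNIV \<subseteq> W \<and>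
           (\<forall>x. bij (frechet_derivative f (at x))) \<and> (\<forall>x\<in>K. f x = x)))"

end

theory Submission
  imports Defs
begin

text \<open>
Both curves are compared through their lifts to \<open>W\<close>, which is an open part of the plane.

From a regular homotopy to homotopy and index: lift the homotopy to \<open>W\<close>. The covering projection is
a local diffeomorphism, so the lifted curves are regular and their velocities depend continuously
on both parameters; a continuous logarithm of the velocity on the parameter square provides angle
functions for all stages at once. All lifts have the same two end points, because these move in
discrete fibres. Base point and base direction are fixed, hence so are the directions of the
velocities at both ends of the lifts. The end values of the angle are therefore continuous in the
stage and fixed modulo \<open>2\<pi>\<close>, so they are constant, and with them the index
(lemma \<open>regular_homotopy_imp_i_index_eq\<close>).

From homotopy and index to a regular homotopy: homotopic loops have lifts with the same end point,
and since the direction of each loop at its end is the base direction, the lifts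
also have the same directions at both ends. Equality
of the indices means that the angle functions can be chosen to agree at both ends. The plane then
contains a regular homotopy between the two lifts, with fixed end points and end directions: this is
a version of the Whitney-Graustein theorem for arcs (\<open>whitney_graustein_fixed_ends\<close>). It may leave
\<open>W\<close>; but by tameness there is a regular map from the plane to \<open>W\<close> which is the identity near both
lifts, and the composition with this map and with the projection to \<open>M\<close> is the required homotopy
(\<open>regular_homotopy_if_index_eq\<close>).

The heart of the Whitney-Graustein argument is \<open>velocity_interpolation\<close>. Interpolating the moduli and
the angles of the two velocities linearly gives a nowhere vanishing family, but its integral, the
displacement from the first to the last point of the arc, is wrong at intermediate stages. To repair
this, the velocity is multiplied by a rapidly oscillating factor with mean value 1 whose modulus is
everywhere large. By fast oscillation the displacement hardly changes, whereas the speed becomes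
much larger than the error of the displacement; so this error can be subtracted without
creating a zero of the velocity.
\<close>

section \<open>Interpolating velocities with prescribed displacement\<close>

lemma continuous_on_slice:
  assumes "continuous_on (T \<times> I) (\<lambda>(t, u). F t u)" "t \<in> T"
  shows "continuous_on I (F t)"
proof -
  have "continuous_on I (\<lambda>u. case (t, u) of (t, u) \<Rightarrow> F t u)"
    by (rule continuous_on_compose2[OF assms(1)])
       (use assms(2) in \<open>auto intro!: continuous_intros\<close>)
  then show ?thesis by simp
qed

text \<open>A quantitative Riemann-Lebesgue lemma. On each of the \<open>N\<close> intervals the mean of \<open>q\<close> vanishes, so there
\<open>f\<close> may be replaced by its deviation from a constant. The bound depends on \<open>f\<close> only through its modulus
of continuity, hence it is uniform in families of equicontinuous functions.\<close>

lemma oscillating_integral_bound: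
  fixes f q :: "real \<Rightarrow> complex" and N :: nat
  assumes N: "0 < N" and f: "continuous_on {0..1} f" and q: "continuous_on {0..1} q"
    and osc: "\<And>x y. x \<in> {0..1} \<Longrightarrow> y \<in> {0..1} \<Longrightarrow> \<bar>x - y\<bar> \<le> 1 / N \<Longrightarrow> norm (f x - f y) \<le> \<eta>"
    and B: "\<And>x. x \<in> {0..1} \<Longrightarrow> norm (q x) \<le> B"
    and mean: "\<And>k. k < N \<Longrightarrow> integral {k / N..Suc k / N} q = 0"
  shows "norm (integral {0..1} (\<lambda>x. f x * q x)) \<le> \<eta> * B"
proof -
  have fq: "continuous_on {0..1} (\<lambda>x. f x * q x)"
    using f q by (intro continuous_intros)
  have "norm (integral {0..k / N} (\<lambda>x. f x * q x)) \<le> \<eta> * B * (k / N)" if "k \<le> N" for k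
    using that
  proof (induction k)
    case 0
    then show ?case by simp
  next
    case (Suc k)
    let ?I = "{k / N..Suc k / N}"
    have le: "real k / N \<le> Suc k / N" "Suc k / N \<le> (1::real)"
      using Suc.prems N by (auto simp: divide_simps)
    have sub: "?I \<subseteq> {0..1}" "{0..Suc k / N} \<subseteq> {0..1}"
      using le by auto
    have kin: "real k / N \<in> {0..1}"
      using Suc.prems by auto
    have cont_f: "continuous_on ?I f" and cont_q: "continuous_on ?I q" and cont_fq: "continuous_on ?I (\<lambda>x. f x * q x)"
      using sub continuous_on_subset f q fq by blast+
    \<comment> \<open>subtract the value of the factor at the left end of the interval, at no cost\<close>
    have "integral ?I (\<lambda>x. f x * q x)
        = integral ?I (\<lambda>x. f x * q x) - f (k / N) * integral ?I q"
      using mean[of k] Suc.prems by simp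
    also have "\<dots> = integral ?I (\<lambda>x. f x * q x - f (k / N) * q x)"
      using cont_q cont_fq
      by (subst Henstock_Kurzweil_Integration.integral_diff)
         (auto intro!: integrable_continuous_real continuous_intros simp: integral_mult_right)
    also have "norm \<dots> \<le> \<eta> * B * (Suc k / N - k / N)"
    proof (rule integral_bound)
      show "continuous_on ?I (\<lambda>x. f x * q x - f (k / N) * q x)"
        using cont_f cont_q by (intro continuous_intros)
      fix x assume x: "x \<in> ?I"
      have "\<bar>x - k / N\<bar> \<le> 1 / N"
        using x by (auto simp: add_divide_distrib)
      then have "norm (f x - f (k / N)) \<le> \<eta>"
        using osc x sub kin by blast
      moreover have "norm (q x) \<le> B"
        using B x sub by blast
      ultimately have "norm ((f x - f (k / N)) * q x) \<le> \<eta> * B"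
        unfolding norm_mult by (meson mult_mono norm_ge_zero order_trans)
      then show "norm (f x * q x - f (k / N) * q x) \<le> \<eta> * B"
        by (simp add: algebra_simps)
    qed (use le in auto)
    finally have "norm (integral ?I (\<lambda>x. f x * q x)) \<le> \<eta> * B * (Suc k / N - k / N)" .
    moreover have "integral {0..Suc k / N} (\<lambda>x. f x * q x)
        = integral {0..k / N} (\<lambda>x. f x * q x) + integral ?I (\<lambda>x. f x * q x)"
    proof (rule Henstock_Kurzweil_Integration.integral_combine[symmetric])
      show "(\<lambda>x. f x * q x) integrable_on {0..Suc k / N}"
        by (rule integrable_continuous_real[OF continuous_on_subset[OF fq sub(2)]])
    qed (use le in auto)
    ultimately have "norm (integral {0..Suc k / N} (\<lambda>x. f x * q x))
        \<le> \<eta> * B * (k / N) + \<eta> * B * (Suc k / N - k / N)"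
      using Suc by (smt (verit) norm_triangle_ineq Suc_leD)
    also have "\<dots> = \<eta> * B * (Suc k / N)"
      by (simp add: algebra_simps)
    finally show ?case .
  qed
  from this[of N] show ?thesis
    using N by simp
qed

text \<open>The square of a point moving up and down on a vertical line in the right half plane. It avoids zero and
does not wind around it, it is positive at integer multiples of the period, and it is constantly
\<open>1\<close> for \<open>e = 0\<close>. The distance of the line from the origin is balanced against the amplitude so that
the mean over a period is \<open>1\<close> for every \<open>e\<close>, although the modulus never falls below \<open>1 + e\<close>.\<close>

definition corrugation :: "real \<Rightarrow> nat \<Rightarrow> real \<Rightarrow> complex" where
  "corrugation e N u = (Complex (sqrt (1 + e)) (sqrt (2 * e) * sin (2 * pi * N * u)))\<^sup>2"

lemma corrugation_minus_1:
  assumes "0 \<le> e"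
  shows "corrugation e N u - 1
    = Complex (e * cos (4 * pi * N * u)) (2 * sqrt (1 + e) * sqrt (2 * e) * sin (2 * pi * N * u))"
proof -
  have "cos (4 * pi * N * u) = 1 - 2 * (sin (2 * pi * N * u))\<^sup>2"
    using cos_double_sin[of "2 * pi * N * u"] by (simp add: algebra_simps)
  moreover have "(sqrt (1 + e))\<^sup>2 = 1 + e" "(sqrt (2 * e))\<^sup>2 = 2 * e"
    using assms by auto
  ultimately show ?thesis
    unfolding corrugation_def complex_eq_iff
    by (simp add: Re_power2 Im_power2 power_mult_distrib) (simp add: algebra_simps)
qed

lemma norm_corrugation_ge:
  assumes "0 \<le> e"
  shows "1 + e \<le> norm (corrugation e N u)"
  using assms by (simp add: corrugation_def norm_power cmod_power2 del: real_sqrt_mult)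

lemma corrugation_at_period:
  assumes "0 \<le> e" "u = 0 \<or> u = 1"
  shows "corrugation e N u = of_real (1 + e)"
proof -
  have "sin (2 * pi * N * u) = 0"
    using assms(2) sin_npi2[of "2 * N"] by (auto simp: mult_ac)
  then show ?thesis
    using assms(1) by (simp add: corrugation_def complex_eq_iff Re_power2 Im_power2)
qed

lemma integral_corrugation_minus_1:
  assumes "0 \<le> e" "0 < N"
  shows "integral {k / N..Suc k / N} (\<lambda>u. corrugation e N u - 1) = 0"
proof -
  let ?c = "2 * sqrt (1 + e) * sqrt (2 * e)"
  define Q where "Q u = of_real (e * sin (4 * pi * N * u) / (4 * pi * N))
    - \<i> * of_real (?c * cos (2 * pi * N * u) / (2 * pi * N))" for u :: real
  have "((\<lambda>u. corrugation e N u - 1) has_integral Q (Suc k / N) - Q (k / N)) {k / N..Suc k / N}"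
  proof (rule fundamental_theorem_of_calculus)
    show "real k / N \<le> Suc k / N"
      by (simp add: divide_right_mono)
    fix u :: real
    have "(Q has_vector_derivative of_real (e * cos (4 * pi * N * u))
        - \<i> * of_real (- ?c * sin (2 * pi * N * u))) (at u within {k / N..Suc k / N})"
      unfolding Q_def using assms(2)
      by (auto intro!: derivative_eq_intros has_vector_derivative_of_real
            simp: field_simps simp flip: of_real_mult)
    then show "(Q has_vector_derivative corrugation e N u - 1) (at u within {k / N..Suc k / N})"
      by (simp add: corrugation_minus_1[OF assms(1)] Complex_eq)
  qed
  moreover have Q: "Q (j / N) = - \<i> * of_real (?c / (2 * pi * N))" for j :: nat
  proof -
    have "4 * pi * N * (j / N) = real (4 * j) * pi" "2 * pi * N * (j / N) = 2 * real j * pi"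
      using assms(2) by simp_all
    then show ?thesis
      unfolding Q_def by (simp only: sin_npi cos_2npi) simp
  qed
  ultimately show ?thesis
    using Q[of k] Q[of "Suc k"] by (simp only: integral_unique diff_self)
qed

text \<open>Write \<open>F t\<close> for the field with linearly interpolated moduli and angles and \<open>m t\<close> for its integral. The
excess \<open>E t\<close> of the corrugation is taken proportional to the error \<open>m t - d\<close>. It thus vanishes at
both ends of the interpolation, where nothing must change, and otherwise it makes the speed exceed the
error. What remains of the error is subtracted with the weight \<open>\<beta>\<close>, which vanishes at the ends of the
interval because the end directions have to be kept.\<close>

lemma velocity_interpolation:
  fixes r\<^sub>0 r\<^sub>1 \<theta>\<^sub>0 \<theta>\<^sub>1 :: "real \<Rightarrow> real"
  assumes cont: "continuous_on {0..1} r\<^sub>0" "continuous_on {0..1} r\<^sub>1"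
      "continuous_on {0..1} \<theta>\<^sub>0" "continuous_on {0..1} \<theta>\<^sub>1"
    and pos: "\<And>u. u \<in> {0..1} \<Longrightarrow> 0 < r\<^sub>0 u" "\<And>u. u \<in> {0..1} \<Longrightarrow> 0 < r\<^sub>1 u"
    and ends: "\<theta>\<^sub>0 0 = \<theta>\<^sub>1 0" "\<theta>\<^sub>0 1 = \<theta>\<^sub>1 1"
    and int: "((\<lambda>u. r\<^sub>0 u *\<^sub>R cis (\<theta>\<^sub>0 u)) has_integral d) {0..1}"
      "((\<lambda>u. r\<^sub>1 u *\<^sub>R cis (\<theta>\<^sub>1 u)) has_integral d) {0..1}"
  obtains V :: "real \<Rightarrow> real \<Rightarrow> complex" where
    "continuous_on ({0..1} \<times> {0..1}) (\<lambda>(t, u). V t u)"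
    "\<And>t u. t \<in> {0..1} \<Longrightarrow> u \<in> {0..1} \<Longrightarrow> V t u \<noteq> 0"
    "\<And>u. V 0 u = r\<^sub>0 u *\<^sub>R cis (\<theta>\<^sub>0 u)" "\<And>u. V 1 u = r\<^sub>1 u *\<^sub>R cis (\<theta>\<^sub>1 u)"
    "\<And>t. t \<in> {0..1} \<Longrightarrow> (V t has_integral d) {0..1}"
    "\<And>t. t \<in> {0..1} \<Longrightarrow> \<exists>c>0. V t 0 = c *\<^sub>R cis (\<theta>\<^sub>0 0)"
    "\<And>t. t \<in> {0..1} \<Longrightarrow> \<exists>c>0. V t 1 = c *\<^sub>R cis (\<theta>\<^sub>0 1)"
proof -
  let ?Q = "{0..1::real} \<times> {0..1::real}"
  define r where "r t u = (1 - t) * r\<^sub>0 u + t * r\<^sub>1 u" for t u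
  define \<theta> where "\<theta> t u = (1 - t) * \<theta>\<^sub>0 u + t * \<theta>\<^sub>1 u" for t u
  define F where "F t u = r t u *\<^sub>R cis (\<theta> t u)" for t u
  define m where "m t = integral {0..1} (F t)" for t
  have cont2: "continuous_on ?Q (\<lambda>z. r\<^sub>0 (snd z))" "continuous_on ?Q (\<lambda>z. r\<^sub>1 (snd z))"
     "continuous_on ?Q (\<lambda>z. \<theta>\<^sub>0 (snd z))" "continuous_on ?Q (\<lambda>z. \<theta>\<^sub>1 (snd z))"
    using cont by (auto intro!: continuous_on_compose2[OF _ continuous_on_snd[OF continuous_on_id]])
  have F_cont: "continuous_on ?Q (\<lambda>(t, u). F t u)"
    unfolding F_def r_def \<theta>_def case_prod_beta cis_conv_exp
    using cont2 by (intro continuous_intros) auto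
  have m_cont: "continuous_on {0..1} m"
    unfolding m_def using integral_continuous_on_param[of "{0..1}" 0 1 F] F_cont by simp
  have m01: "m 0 = d" "m 1 = d"
    using int by (simp_all add: m_def F_def[abs_def] r_def \<theta>_def integral_unique)
  have "compact ((\<lambda>u. min (r\<^sub>0 u) (r\<^sub>1 u)) ` {0..1})"
    using cont by (intro compact_continuous_image continuous_intros) auto
  then obtain u\<^sub>m where um: "u\<^sub>m \<in> {0..1}"
    and um_le: "\<And>u. u \<in> {0..1} \<Longrightarrow> min (r\<^sub>0 u\<^sub>m) (r\<^sub>1 u\<^sub>m) \<le> min (r\<^sub>0 u) (r\<^sub>1 u)"
    using compact_attains_inf[of "(\<lambda>u. min (r\<^sub>0 u) (r\<^sub>1 u)) ` {0..1}"] by auto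
  define \<mu> where "\<mu> = min (r\<^sub>0 u\<^sub>m) (r\<^sub>1 u\<^sub>m)"
  have \<mu>: "0 < \<mu>"
    using pos um by (simp add: \<mu>_def)
  have r_ge: "\<mu> \<le> r t u" if "t \<in> {0..1}" "u \<in> {0..1}" for t u
  proof -
    have "\<mu> \<le> r\<^sub>0 u" "\<mu> \<le> r\<^sub>1 u"
      using um_le[OF that(2)] by (auto simp: \<mu>_def)
    then have "(1 - t) * \<mu> + t * \<mu> \<le> r t u"
      unfolding r_def using that by (intro add_mono mult_left_mono) auto
    then show ?thesis
      by (simp add: algebra_simps)
  qed
  \<comment> \<open>with the factor 4 the speed, at least \<open>\<mu> (1 + E t)\<close>, dominates \<open>3/2\<close> times the error\<close>
  define E where "E t = 4 / \<mu> * norm (m t - d)" for t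
  have E_ge: "0 \<le> E t" for t
    using \<mu> by (simp add: E_def)
  have E_cont: "continuous_on {0..1} E"
    unfolding E_def using m_cont by (intro continuous_intros)
  have E_cont2: "continuous_on ?Q (\<lambda>z. E (fst z))"
    using E_cont by (auto intro!: continuous_on_compose2[OF _ continuous_on_fst[OF continuous_on_id]])
  have P_cont: "continuous_on ?Q (\<lambda>(t, u). corrugation (E t) N u)" for N
    unfolding corrugation_def Complex_eq case_prod_beta
    using E_cont2 by (intro continuous_intros)
  obtain B where B: "0 < B" "\<And>t. t \<in> {0..1} \<Longrightarrow> E t + 2 * sqrt (1 + E t) * sqrt (2 * E t) \<le> B"
  proof -
    have "compact ((\<lambda>t. E t + 2 * sqrt (1 + E t) * sqrt (2 * E t)) ` {0..1})"
      using E_cont by (intro compact_continuous_image continuous_intros) auto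
    then obtain B where "0 < B" "\<forall>x \<in> (\<lambda>t. E t + 2 * sqrt (1 + E t) * sqrt (2 * E t)) ` {0..1}. norm x \<le> B"
      using bounded_pos compact_imp_bounded by metis
    then show ?thesis
      by (intro that[of B]) (auto intro: order_trans[OF abs_ge_self])
  qed
  have P_bound: "norm (corrugation (E t) N u - 1) \<le> B" if "t \<in> {0..1}" for t u N
  proof -
    have "norm (corrugation (E t) N u - 1)
        \<le> \<bar>E t * cos (4 * pi * N * u)\<bar> + \<bar>2 * sqrt (1 + E t) * sqrt (2 * E t) * sin (2 * pi * N * u)\<bar>"
      unfolding corrugation_minus_1[OF E_ge] by (metis cmod_le complex.sel)
    also have "\<dots> \<le> E t * 1 + 2 * sqrt (1 + E t) * sqrt (2 * E t) * 1"
      unfolding abs_mult using E_ge[of t]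
      by (intro add_mono mult_mono abs_sin_le_one abs_cos_le_one) auto
    finally show ?thesis
      using B(2)[OF that] by simp
  qed
  \<comment> \<open>the frequency will be so high that the corrugation shifts the integral by at most \<open>\<mu> / 8\<close>\<close>
  define \<eta> where "\<eta> = \<mu> / (8 * B)"
  have \<eta>: "0 < \<eta>" "\<eta> * B = \<mu> / 8"
    using B(1) \<mu> by (auto simp: \<eta>_def)
  have "uniformly_continuous_on ?Q (\<lambda>(t, u). F t u)"
    by (intro compact_uniformly_continuous F_cont compact_Times compact_Icc)
  then obtain \<delta> where \<delta>: "0 < \<delta>"
    "\<And>z z'. z \<in> ?Q \<Longrightarrow> z' \<in> ?Q \<Longrightarrow> dist z z' < \<delta> \<Longrightarrow> dist (case z of (t, u) \<Rightarrow> F t u) (case z' of (t, u) \<Rightarrow> F t u) < \<eta>"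
    unfolding uniformly_continuous_on_def using \<eta>(1) by metis
  obtain N :: nat where N: "0 < N" "1 / N < \<delta>"
    using \<delta>(1) by (metis nat_approx_posE of_nat_0_less_iff zero_less_Suc)
  define P where "P t = corrugation (E t) N" for t
  define I where "I t = integral {0..1} (\<lambda>u. F t u * P t u)" for t
  have FP_cont: "continuous_on ?Q (\<lambda>(t, u). F t u * P t u)"
    using F_cont P_cont[of N] unfolding P_def case_prod_beta by (intro continuous_intros)
  have I_cont: "continuous_on {0..1} I"
    unfolding I_def using integral_continuous_on_param[of "{0..1}" 0 1 "\<lambda>t u. F t u * P t u"] FP_cont by simp
  have I_near: "norm (I t - m t) \<le> \<mu> / 8" if t: "t \<in> {0..1}" for t
  proof -
    have c: "continuous_on {0..1} (F t)" "continuous_on {0..1} (P t)"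
      using continuous_on_slice[OF F_cont t] continuous_on_slice[OF P_cont[of N] t] by (simp_all add: P_def)
    have "I t - m t = integral {0..1} (\<lambda>u. F t u * P t u - F t u)"
      unfolding I_def m_def using c
      by (intro Henstock_Kurzweil_Integration.integral_diff[symmetric] integrable_continuous_real continuous_intros)
    also have "\<dots> = integral {0..1} (\<lambda>u. F t u * (P t u - 1))"
      by (simp add: algebra_simps)
    also have "norm \<dots> \<le> \<eta> * B"
    proof (rule oscillating_integral_bound[OF N(1) c(1)])
      show "continuous_on {0..1} (\<lambda>u. P t u - 1)"
        using c by (intro continuous_intros)
      show "norm (F t x - F t y) \<le> \<eta>" if "x \<in> {0..1}" "y \<in> {0..1}" "\<bar>x - y\<bar> \<le> 1 / N" for x y
        using \<delta>(2)[of "(t, x)" "(t, y)"] that t N(2) by (simp add: dist_Pair_Pair dist_norm)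
      show "integral {k / N..Suc k / N} (\<lambda>u. P t u - 1) = 0" for k
        unfolding P_def by (rule integral_corrugation_minus_1[OF E_ge N(1)])
    qed (use P_bound t in \<open>auto simp: P_def\<close>)
    finally show ?thesis
      using \<eta>(2) by simp
  qed
  \<comment> \<open>a weight of integral 1, zero at both ends, and bounded by \<open>3/2\<close>\<close>
  define \<beta> :: "real \<Rightarrow> real" where "\<beta> u = 6 * u * (1 - u)" for u
  have \<beta>_int: "(\<beta> has_integral 1) {0..1}"
  proof -
    have "(\<beta> has_integral (3 * 1\<^sup>2 - 2 * 1 ^ 3) - (3 * 0\<^sup>2 - 2 * 0 ^ 3)) {0..1}"
      by (rule fundamental_theorem_of_calculus)
         (auto intro!: derivative_eq_intros simp: \<beta>_def algebra_simps power2_eq_square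
            simp flip: has_real_derivative_iff_has_vector_derivative)
    then show ?thesis by simp
  qed
  have \<beta>_bound: "0 \<le> \<beta> u" "\<beta> u \<le> 3 / 2" if "u \<in> {0..1}" for u
    using that sum_power2_ge_zero[of "2 * u - 1" 0] mult_left_le[of u u]
    by (auto simp: \<beta>_def power2_eq_square algebra_simps)
  define V where "V t u = F t u * P t u - \<beta> u *\<^sub>R (I t - d)" for t u
  have I01: "I 0 = d" "I 1 = d" and P01: "P 0 u = 1" "P 1 u = 1" for u
  proof -
    have "E 0 = 0" "E 1 = 0"
      using m01 by (simp_all add: E_def)
    then show P01: "P 0 u = 1" "P 1 u = 1" for u
      by (simp_all add: P_def corrugation_def complex_eq_iff)
    show "I 0 = d" "I 1 = d"
      using m01 by (simp_all add: I_def m_def P01)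
  qed
  show thesis
  proof (rule that[of V])
    have "continuous_on ?Q (\<lambda>z. I (fst z))"
      using I_cont by (auto intro!: continuous_on_compose2[OF _ continuous_on_fst[OF continuous_on_id]])
    then have "continuous_on ?Q (\<lambda>z. \<beta> (snd z) *\<^sub>R (I (fst z) - d))"
      unfolding \<beta>_def by (intro continuous_intros)
    from continuous_on_diff[OF FP_cont[unfolded case_prod_beta] this]
    show "continuous_on ?Q (\<lambda>(t, u). V t u)"
      by (simp add: V_def case_prod_beta)
    show "V 0 u = r\<^sub>0 u *\<^sub>R cis (\<theta>\<^sub>0 u)" "V 1 u = r\<^sub>1 u *\<^sub>R cis (\<theta>\<^sub>1 u)" for u
      by (simp_all add: V_def P01 I01 F_def r_def \<theta>_def)
  next
    fix t :: real assume t: "t \<in> {0..1}"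
    have \<theta>_ends: "\<theta> t 0 = \<theta>\<^sub>0 0" "\<theta> t 1 = \<theta>\<^sub>0 1"
      using ends by (auto simp: \<theta>_def algebra_simps)
    show "\<exists>c>0. V t 0 = c *\<^sub>R cis (\<theta>\<^sub>0 0)"
      using r_ge[OF t, of 0] \<mu> E_ge[of t]
      by (intro exI[of _ "r t 0 * (1 + E t)"])
         (auto simp: V_def F_def \<theta>_ends \<beta>_def P_def corrugation_at_period scaleR_conv_of_real)
    show "\<exists>c>0. V t 1 = c *\<^sub>R cis (\<theta>\<^sub>0 1)"
      using r_ge[OF t, of 1] \<mu> E_ge[of t]
      by (intro exI[of _ "r t 1 * (1 + E t)"])
         (auto simp: V_def F_def \<theta>_ends \<beta>_def P_def corrugation_at_period scaleR_conv_of_real)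
    have "((\<lambda>u. F t u * P t u) has_integral I t) {0..1}"
      unfolding I_def using continuous_on_slice[OF FP_cont t]
      by (intro integrable_integral integrable_continuous_real)
    from has_integral_diff[OF this has_integral_scaleR_left[OF \<beta>_int, of "I t - d"]]
    show "(V t has_integral d) {0..1}"
      by (simp add: V_def[abs_def])
    fix u :: real assume u: "u \<in> {0..1}"
    have "norm (\<beta> u *\<^sub>R (I t - d)) \<le> 3 / 2 * (norm (m t - d) + \<mu> / 8)"
    proof -
      have "norm (I t - d) \<le> norm (m t - d) + \<mu> / 8"
        using I_near[OF t] norm_triangle_ineq[of "I t - m t" "m t - d"] by simp
      then show ?thesis
        unfolding norm_scaleR using \<beta>_bound[OF u] by (intro mult_mono) auto
    qed
    also have "\<dots> < \<mu> + 4 * norm (m t - d)"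
      using \<mu> norm_ge_zero[of "m t - d"] unfolding distrib_left by linarith
    also have "\<dots> = \<mu> * (1 + E t)"
      using \<mu> by (simp add: E_def field_simps)
    also have "\<dots> \<le> norm (F t u * P t u)"
      unfolding norm_mult using r_ge[OF t u] \<mu> norm_corrugation_ge[OF E_ge] E_ge[of t]
      by (intro mult_mono) (auto simp: F_def P_def)
    finally show "V t u \<noteq> 0"
      by (auto simp: V_def)
  qed
qed

section \<open>Lifting through a covering of an arbitrary space\<close>

text \<open>The sheets over the preimage of an evenly covered set \<open>T\<close> are cut out by the sheets over \<open>T\<close>. The point of
the pullback is to trade the base \<open>M\<close>, which is merely a topological space, for the parameter space \<open>Q\<close>
of a map into it.\<close>

lemma covering_space_pullback:
  fixes h :: "'c::topological_space \<Rightarrow> 'b::topological_space"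
    and \<pi> :: "'a::topological_space \<Rightarrow> 'b"
  assumes cov: "covering_space W \<pi> M" and h: "continuous_on Q h" "h ` Q \<subseteq> M"
  shows "covering_space {(x, w). x \<in> Q \<and> w \<in> W \<and> h x = \<pi> w} fst Q"
    (is "covering_space ?E fst Q")
proof
  show "continuous_on ?E fst"
    by (intro continuous_intros)
  show "fst ` ?E = Q"
  proof -
    have "\<exists>w. w \<in> W \<and> h x = \<pi> w" if "x \<in> Q" for x
      using covering_space_imp_surjective[OF cov] h(2) that by blast
    then show ?thesis
      by (force simp: image_iff)
  qed
  fix x assume x: "x \<in> Q"
  then obtain T v where T: "h x \<in> T" "openin (top_of_set M) T"
    and v: "\<Union>v = W \<inter> \<pi> -` T" "\<And>u. u \<in> v \<Longrightarrow> openin (top_of_set W) u" "pairwise disjnt v"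
      "\<And>u. u \<in> v \<Longrightarrow> \<exists>q. homeomorphism u T \<pi> q"
  proof -
    have "h x \<in> M"
      using x h(2) by blast
    with cov have "\<exists>T. h x \<in> T \<and> openin (top_of_set M) T \<and>
        (\<exists>v. \<Union>v = W \<inter> \<pi> -` T \<and> (\<forall>u\<in>v. openin (top_of_set W) u) \<and> pairwise disjnt v \<and>
          (\<forall>u\<in>v. \<exists>q. homeomorphism u T \<pi> q))"
      by (simp add: covering_space_def)
    then show ?thesis
      using that by (elim exE conjE) (rule that, auto)
  qed
  define sheet where "sheet u = {(y, w). y \<in> Q \<and> w \<in> u \<and> h y = \<pi> w}" for u
  show "\<exists>T'. x \<in> T' \<and> openin (top_of_set Q) T' \<and>
      (\<exists>v'. \<Union>v' = ?E \<inter> fst -` T' \<and> (\<forall>u\<in>v'. openin (top_of_set ?E) u) \<and> pairwise disjnt v' \<and>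
        (\<forall>u\<in>v'. \<exists>q. homeomorphism u T' fst q))"
  proof (intro exI[of _ "Q \<inter> h -` T"] exI[of _ "sheet ` v"] conjI ballI)
    show "x \<in> Q \<inter> h -` T"
      using x T by simp
    show "openin (top_of_set Q) (Q \<inter> h -` T)"
      using continuous_openin_preimage[OF h(1) _ T(2)] h(2) by blast
    have S: "(y, w) \<in> \<Union>(sheet ` v) \<longleftrightarrow> (y, w) \<in> ?E \<inter> fst -` (Q \<inter> h -` T)" for y w
    proof -
      have "(\<exists>u\<in>v. w \<in> u) \<longleftrightarrow> w \<in> W \<and> \<pi> w \<in> T"
        unfolding Union_iff[symmetric] v(1) by simp
      moreover have "(y, w) \<in> \<Union>(sheet ` v) \<longleftrightarrow> y \<in> Q \<and> h y = \<pi> w \<and> (\<exists>u\<in>v. w \<in> u)"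
        by (auto simp: sheet_def)
      ultimately show ?thesis
        by auto
    qed
    show "\<Union>(sheet ` v) = ?E \<inter> fst -` (Q \<inter> h -` T)"
    proof (rule set_eqI)
      show "z \<in> \<Union>(sheet ` v) \<longleftrightarrow> z \<in> ?E \<inter> fst -` (Q \<inter> h -` T)" for z
        by (cases z) (simp only: S)
    qed
    show "pairwise disjnt (sheet ` v)"
      using v(3) by (auto simp: pairwise_def disjnt_def sheet_def)
  next
    fix s assume "s \<in> sheet ` v"
    then obtain u where u: "u \<in> v" "s = sheet u"
      by blast
    have uW: "u \<subseteq> W" "\<pi> ` u \<subseteq> T"
      using v(1) u(1) by blast+
    have "continuous_on ?E snd"
      by (intro continuous_intros)
    then have "openin (top_of_set ?E) (?E \<inter> snd -` u)"
      by (rule continuous_openin_preimage[OF _ _ v(2)[OF u(1)]]) auto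
    moreover have "?E \<inter> snd -` u = s"
      using uW by (auto simp: u sheet_def)
    ultimately show "openin (top_of_set ?E) s"
      by simp
    obtain q where q: "homeomorphism u T \<pi> q"
      using v(4)[OF u(1)] by blast
    have "homeomorphism s (Q \<inter> h -` T) fst (\<lambda>y. (y, q (h y)))"
    proof (rule homeomorphismI)
      show "continuous_on s fst"
        by (intro continuous_intros)
      have "continuous_on (Q \<inter> h -` T) (\<lambda>y. q (h y))"
        by (rule continuous_on_compose2[OF homeomorphism_cont2[OF q]])
           (auto intro: continuous_on_subset[OF h(1)])
      then show "continuous_on (Q \<inter> h -` T) (\<lambda>y. (y, q (h y)))"
        by (intro continuous_intros)
      show "fst ` s \<subseteq> Q \<inter> h -` T"
        using uW by (auto simp: u sheet_def)
      show "(\<lambda>y. (y, q (h y))) ` (Q \<inter> h -` T) \<subseteq> s"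
        using homeomorphism_image2[OF q] homeomorphism_apply2[OF q] by (auto simp: u sheet_def)
      show "(fst z, q (h (fst z))) = z" if "z \<in> s" for z
        using that homeomorphism_apply1[OF q] by (auto simp: u sheet_def)
    qed auto
    then show "\<exists>q. homeomorphism s (Q \<inter> h -` T) fst q"
      by blast
  qed
qed

text \<open>A lift of \<open>h\<close> is a section of the pulled back covering, that is, a lift of the identity of \<open>Q\<close>; and \<open>Q\<close>
is a subset of a normed space, where the lifting theorem applies.\<close>

lemma covering_space_lift_simply_connected:
  fixes h :: "'c::real_normed_vector \<Rightarrow> 'b::topological_space"
    and \<pi> :: "'a::real_normed_vector \<Rightarrow> 'b"
  assumes cov: "covering_space W \<pi> M" and h: "continuous_on Q h" "h ` Q \<subseteq> M"
    and Q: "simply_connected Q" "locally path_connected Q"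
    and z: "z \<in> Q" "w \<in> W" "h z = \<pi> w"
  obtains k where "continuous_on Q k" "k ` Q \<subseteq> W" "k z = w" "\<And>x. x \<in> Q \<Longrightarrow> \<pi> (k x) = h x"
proof -
  let ?E = "{(x, w). x \<in> Q \<and> w \<in> W \<and> h x = \<pi> w}"
  obtain g where g: "continuous_on Q g" "g \<in> Q \<rightarrow> ?E" "g z = (z, w)" "\<And>x. x \<in> Q \<Longrightarrow> fst (g x) = x"
    by (rule covering_space_lift_strong[OF covering_space_pullback[OF cov h], of "(z, w)" z Q "\<lambda>x. x"])
       (use z Q in auto)
  have g': "snd (g x) \<in> W \<and> \<pi> (snd (g x)) = h x" if "x \<in> Q" for x
  proof -
    have "g x \<in> ?E" "fst (g x) = x"
      using funcset_mem[OF g(2) that] g(4)[OF that] by auto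
    then show ?thesis
      by (cases "g x") auto
  qed
  show thesis
    by (rule that[of "\<lambda>x. snd (g x)"]) (use g g' in \<open>auto intro!: continuous_intros\<close>)
qed

text \<open>Over an edge of the square that is mapped to a point the lift is constant, by uniqueness of lifts.\<close>

lemma covering_space_lift_square:
  fixes \<sigma> :: "real \<Rightarrow> real \<Rightarrow> 'b::topological_space"
    and \<pi> :: "'a::real_normed_vector \<Rightarrow> 'b"
  assumes cov: "covering_space W \<pi> M" and "a \<le> b"
    and \<sigma>: "continuous_on ({0..1} \<times> {a..b}) (\<lambda>(t, u). \<sigma> t u)"
      "\<And>t u. t \<in> {0..1} \<Longrightarrow> u \<in> {a..b} \<Longrightarrow> \<sigma> t u \<in> M"
    and ends: "\<And>t. t \<in> {0..1} \<Longrightarrow> \<sigma> t a = \<pi> w" "\<And>t. t \<in> {0..1} \<Longrightarrow> \<sigma> t b = x"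
    and w: "w \<in> W"
  obtains k where "continuous_on ({0..1} \<times> {a..b}) (\<lambda>(t, u). k t u)"
    "\<And>t u. t \<in> {0..1} \<Longrightarrow> u \<in> {a..b} \<Longrightarrow> k t u \<in> W"
    "\<And>t u. t \<in> {0..1} \<Longrightarrow> u \<in> {a..b} \<Longrightarrow> \<pi> (k t u) = \<sigma> t u"
    "\<And>t. t \<in> {0..1} \<Longrightarrow> k t a = w" "\<And>t. t \<in> {0..1} \<Longrightarrow> k t b = k 0 b"
proof -
  let ?Q = "{0..1::real} \<times> {a..b}"
  have "convex ?Q"
    by (intro convex_Times convex_closed_interval)
  then have "simply_connected ?Q" "locally path_connected ?Q"
    by (simp_all add: convex_imp_simply_connected convex_imp_locally_path_connected)
  then obtain k where k: "continuous_on ?Q k" "k ` ?Q \<subseteq> W" "k (0, a) = w"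
    "\<And>z. z \<in> ?Q \<Longrightarrow> \<pi> (k z) = (\<lambda>(t, u). \<sigma> t u) z"
    using covering_space_lift_simply_connected[OF cov \<sigma>(1), of "(0, a)" w] \<sigma>(2) w ends(1)[of 0] \<open>a \<le> b\<close>
    by (auto simp: image_subset_iff)
  \<comment> \<open>compare the lift along a collapsed edge with the constant lift\<close>
  have edge: "k (t, c) = k (0, c)"
    if c: "c \<in> {a..b}" "\<And>s. s \<in> {0..1} \<Longrightarrow> \<sigma> s c = y" and t: "t \<in> {0..1}" for c y t
  proof (rule covering_space_lift_unique[OF cov, where T = "{0..1}" and a = 0
      and f = "\<lambda>_. y" and ?g1.0 = "\<lambda>t. k (t, c)" and ?g2.0 = "\<lambda>_. k (0, c)"])
    show "continuous_on {0..1} (\<lambda>t. k (t, c))"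
      by (rule continuous_on_compose2[OF k(1)]) (use c in \<open>auto intro!: continuous_intros\<close>)
    show "(\<lambda>_. y) \<in> {0..1} \<rightarrow> M"
      using c \<sigma>(2)[of 0 c] by auto
    show "(\<lambda>t. k (t, c)) \<in> {0..1} \<rightarrow> W" "(\<lambda>_. k (0, c)) \<in> {0..1} \<rightarrow> W"
      using k(2) c(1) by (auto simp: image_subset_iff)
    show "y = \<pi> (k (s, c))" "y = \<pi> (k (0, c))" if "s \<in> {0..1}" for s
      using k(4)[of "(s, c)"] k(4)[of "(0, c)"] c(2)[of s] c(2)[of 0] that c(1) by simp_all
  qed (use t in auto)
  show thesis
  proof (rule that[of "\<lambda>t u. k (t, u)"])
    show "k (t, a) = w" if "t \<in> {0..1}" for t
      using edge[of a, OF _ ends(1) that] \<open>a \<le> b\<close> k(3) by simp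
    show "k (t, b) = k (0, b)" if "t \<in> {0..1}" for t
      using edge[of b, OF _ ends(2) that] \<open>a \<le> b\<close> by simp
  qed (use k in \<open>auto simp: image_subset_iff\<close>)
qed

section \<open>Velocities of projected and lifted curves\<close>

lemma linear_complex_basis:
  assumes "linear (D :: complex \<Rightarrow> complex)"
  shows "D v = Re v *\<^sub>R D 1 + Im v *\<^sub>R D \<i>"
proof -
  have "v = Re v *\<^sub>R 1 + Im v *\<^sub>R \<i>"
    by (simp add: complex_eq_iff)
  then show ?thesis
    by (metis assms linear_add linear_scale)
qed

text \<open>The expression is, up to sign, the determinant of \<open>D\<close>.\<close>

lemma linear_injective_det_nonzero:
  assumes "linear (D :: complex \<Rightarrow> complex)" "inj D"
  shows "Im (D 1 * cnj (D \<i>)) \<noteq> 0"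
proof
  assume 0: "Im (D 1 * cnj (D \<i>)) = 0"
  define \<rho> where "\<rho> = Re (D 1 * cnj (D \<i>))"
  have "D 1 * cnj (D \<i>) = of_real \<rho>"
    using 0 by (simp add: complex_eq_iff \<rho>_def)
  then have "D 1 * (cnj (D \<i>) * D \<i>) = of_real \<rho> * D \<i>"
    by (simp only: mult.assoc[symmetric])
  then have "(norm (D \<i>))\<^sup>2 *\<^sub>R D 1 + (- \<rho>) *\<^sub>R D \<i> = 0"
    by (simp only: scaleR_conv_of_real of_real_minus complex_norm_square mult_ac) simp
  then have "D (Complex ((norm (D \<i>))\<^sup>2) (- \<rho>)) = D 0"
    using linear_complex_basis[OF assms(1), of "Complex ((norm (D \<i>))\<^sup>2) (- \<rho>)"] linear_0[OF assms(1)]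
    by simp
  then have "Complex ((norm (D \<i>))\<^sup>2) (- \<rho>) = 0"
    using assms(2) by (simp only: inj_eq)
  then have "D \<i> = D 0"
    using linear_0[OF assms(1)] by (simp add: complex_eq_iff)
  then have "\<i> = 0"
    using assms(2) by (simp only: inj_eq)
  then show False by simp
qed

lemma continuous_on_linear_family_apply:
  fixes D :: "'z::topological_space \<Rightarrow> complex \<Rightarrow> complex"
  assumes "\<And>z. z \<in> T \<Longrightarrow> linear (D z)" "\<And>v. continuous_on T (\<lambda>z. D z v)" "continuous_on T X"
  shows "continuous_on T (\<lambda>z. D z (X z))"
proof -
  have "continuous_on T (\<lambda>z. Re (X z) *\<^sub>R D z 1 + Im (X z) *\<^sub>R D z \<i>)"
    using assms by (intro continuous_intros)
  then show ?thesis
    by (rule continuous_on_eq) (simp only: linear_complex_basis[OF assms(1), symmetric])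
qed

text \<open>Cramer's rule expresses \<open>X\<close> by continuous functions.\<close>

lemma continuous_on_linear_family_cancel:
  fixes D :: "'z::topological_space \<Rightarrow> complex \<Rightarrow> complex"
  assumes lin: "\<And>z. z \<in> T \<Longrightarrow> linear (D z)" and inj: "\<And>z. z \<in> T \<Longrightarrow> inj (D z)"
    and cont: "\<And>v. continuous_on T (\<lambda>z. D z v)" and Y: "continuous_on T (\<lambda>z. D z (X z))"
  shows "continuous_on T X"
proof -
  define Z where "Z z = Complex (Im (D z (X z) * cnj (D z \<i>)) / Im (D z 1 * cnj (D z \<i>)))
    (Im (D z (X z) * cnj (D z 1)) / Im (D z \<i> * cnj (D z 1)))" for z
  have det: "Im (D z 1 * cnj (D z \<i>)) \<noteq> 0" "Im (D z \<i> * cnj (D z 1)) \<noteq> 0" if "z \<in> T" for z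
    using linear_injective_det_nonzero[OF lin[OF that] inj[OF that]] by (auto simp: algebra_simps)
  have cramer: "Im ((x *\<^sub>R a + y *\<^sub>R b) * cnj b) = x * Im (a * cnj b)"
    "Im ((x *\<^sub>R a + y *\<^sub>R b) * cnj a) = y * Im (b * cnj a)" for x y and a b :: complex
    by (simp_all add: algebra_simps)
  have "Z z = X z" if "z \<in> T" for z
    unfolding Z_def complex_eq_iff complex.sel
    by (subst (1 2) linear_complex_basis[OF lin[OF that], of "X z"])
       (simp only: cramer nonzero_mult_div_cancel_right det[OF that] not_False_eq_True simp_thms)
  moreover have "continuous_on T Z"
    unfolding Z_def Complex_eq using det cont Y by (intro continuous_intros) auto
  ultimately show ?thesis
    using continuous_on_eq by blast
qed

lemma smooth_on_imp_C1:
  assumes "smooth_on f S"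
  shows "x \<in> S \<Longrightarrow> (f has_derivative frechet_derivative f (at x)) (at x)"
    and "continuous_on S (\<lambda>x. frechet_derivative f (at x) v)"
proof -
  have "C_k_on (Suc 0) f S"
    using assms by (simp add: smooth_on_def)
  then show "x \<in> S \<Longrightarrow> (f has_derivative frechet_derivative f (at x)) (at x)"
    "continuous_on S (\<lambda>x. frechet_derivative f (at x) v)"
    by (simp_all add: frechet_derivative_works[symmetric])
qed

text \<open>If a continuous curve becomes differentiable after composition with a map whose derivative is invertible,
then it is differentiable itself: continuity of the curve first yields a Lipschitz estimate at the point, and
this turns the remainder of \<open>\<phi>\<close> into a remainder for the
curve.\<close>

lemma has_vector_derivative_lift:
  fixes \<kappa> :: "real \<Rightarrow> complex" and \<phi> :: "complex \<Rightarrow> complex"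
  assumes \<phi>: "(\<phi> has_derivative D) (at (\<kappa> u))" and D: "bij D"
    and \<kappa>: "continuous (at u within S) \<kappa>"
    and w: "((\<lambda>s. \<phi> (\<kappa> s)) has_vector_derivative w) (at u within S)"
  shows "(\<kappa> has_vector_derivative inv D w) (at u within S)"
proof -
  have linD: "linear D"
    using \<phi> has_derivative_linear by blast
  then have "linear (inv D)"
    using D by (simp add: bij_betw_def inj_linear_imp_inv_linear)
  then obtain B where B: "0 < B" "\<And>x. norm (inv D x) \<le> B * norm x"
    by (metis bounded_linear.pos_bounded linear_conv_bounded_linear mult.commute)
  have inv_D: "inv D (D x) = x" for x
    using D by (simp add: bij_is_inj)
  let ?\<Delta> = "\<lambda>s. \<phi> (\<kappa> s) - \<phi> (\<kappa> u)"
  have \<phi>_small: "\<forall>\<^sub>F s in at u within S. norm (?\<Delta> s - D (\<kappa> s - \<kappa> u)) \<le> e * norm (\<kappa> s - \<kappa> u)"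
    if "0 < e" for e
  proof -
    have "\<forall>\<^sub>F y in at (\<kappa> u). norm (\<phi> y - \<phi> (\<kappa> u) - D (y - \<kappa> u)) \<le> e * norm (y - \<kappa> u)"
      using \<phi> that unfolding has_derivative_within_alt2 by blast
    then have "\<forall>\<^sub>F y in nhds (\<kappa> u). norm (\<phi> y - \<phi> (\<kappa> u) - D (y - \<kappa> u)) \<le> e * norm (y - \<kappa> u)"
      by (auto simp: eventually_at_filter linear_0[OF linD] elim!: eventually_mono)
    then show ?thesis
      using \<kappa> unfolding continuous_within by (rule eventually_compose_filterlim)
  qed
  have w_small: "\<forall>\<^sub>F s in at u within S. norm (?\<Delta> s - (s - u) *\<^sub>R w) \<le> e * norm (s - u)"
    if "0 < e" for e
    using w that unfolding has_vector_derivative_def has_derivative_within_alt2 by blast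
  \<comment> \<open>the increment of the lift is at most linear in the parameter\<close>
  define C where "C = 2 * B * (norm w + 1)"
  have C: "0 < C"
    using B(1) by (auto simp: C_def intro!: mult_pos_pos add_nonneg_pos)
  have half: "0 < 1 / (2 * B)"
    using B(1) by simp
  have lip: "\<forall>\<^sub>F s in at u within S. norm (\<kappa> s - \<kappa> u) \<le> C * norm (s - u)"
    using w_small[OF zero_less_one] \<phi>_small[OF half]
  proof (eventually_elim, goal_cases)
    case (1 s)
    have "norm (?\<Delta> s) \<le> norm (?\<Delta> s - (s - u) *\<^sub>R w) + norm ((s - u) *\<^sub>R w)"
      using norm_triangle_ineq[of "?\<Delta> s - (s - u) *\<^sub>R w" "(s - u) *\<^sub>R w"] by simp
    also have "\<dots> \<le> (norm w + 1) * \<bar>s - u\<bar>"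
      using 1(1) by (simp add: distrib_right)
    finally have \<Delta>: "norm (?\<Delta> s) \<le> (norm w + 1) * \<bar>s - u\<bar>" .
    have "norm (\<kappa> s - \<kappa> u) \<le> B * norm (D (\<kappa> s - \<kappa> u))"
      using B(2)[of "D (\<kappa> s - \<kappa> u)"] by (simp add: inv_D)
    also have "\<dots> \<le> B * (norm (?\<Delta> s) + norm (?\<Delta> s - D (\<kappa> s - \<kappa> u)))"
      using B(1) norm_triangle_ineq4[of "?\<Delta> s" "?\<Delta> s - D (\<kappa> s - \<kappa> u)"]
      by (intro mult_left_mono) simp_all
    also have "\<dots> \<le> B * ((norm w + 1) * \<bar>s - u\<bar> + 1 / (2 * B) * norm (\<kappa> s - \<kappa> u))"
      using \<Delta> 1 B(1) by (intro mult_left_mono add_mono) auto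
    also have "\<dots> = B * ((norm w + 1) * \<bar>s - u\<bar>) + norm (\<kappa> s - \<kappa> u) / 2"
      using B(1) by (simp add: field_simps)
    finally have "norm (\<kappa> s - \<kappa> u) \<le> 2 * (B * ((norm w + 1) * \<bar>s - u\<bar>))"
      by linarith
    then show ?case
      by (simp add: C_def mult.assoc)
  qed
  show ?thesis
    unfolding has_vector_derivative_def has_derivative_within_alt2
  proof (intro conjI allI impI)
    show "bounded_linear (\<lambda>s. s *\<^sub>R inv D w)"
      by (rule bounded_linear_scaleR_left)
    fix e :: real assume e: "0 < e"
    have e1: "0 < e / (2 * B)" and e2: "0 < e / (2 * B * C)"
      using B(1) C e by simp_all
    show "\<forall>\<^sub>F s in at u within S. norm (\<kappa> s - \<kappa> u - (s - u) *\<^sub>R inv D w) \<le> e * norm (s - u)"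
      using w_small[OF e1] \<phi>_small[OF e2] lip
    proof (eventually_elim, goal_cases)
      case (1 s)
      let ?x = "?\<Delta> s - (s - u) *\<^sub>R w" and ?y = "?\<Delta> s - D (\<kappa> s - \<kappa> u)"
      have "\<kappa> s - \<kappa> u - (s - u) *\<^sub>R inv D w = inv D (?x - ?y)"
        using \<open>linear (inv D)\<close> by (simp add: linear_diff linear_scale inv_D)
      also have "norm \<dots> \<le> B * (norm ?x + norm ?y)"
        using B by (intro order_trans[OF B(2)] mult_left_mono norm_triangle_ineq4) auto
      also have "\<dots> \<le> B * (e / (2 * B) * norm (s - u) + e / (2 * B * C) * (C * norm (s - u)))"
        using 1 B(1) C e
        by (intro mult_left_mono add_mono order_trans[OF 1(2)]) auto
      also have "\<dots> = e * norm (s - u)"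
        using B(1) C by (simp add: field_simps)
      finally show ?case .
    qed
  qed
qed


text \<open>
The notions on \<open>M\<close> are stated in charts, whereas the argument takes place in the plane. In this locale
velocities and directions on \<open>M\<close> are translated into those of lifts.
\<close>

locale covered_surface = riemannian_surface M A g
  for M :: "'m::topological_space set" and A :: "'m chart set" and g :: "'m metric_tensor" +
  fixes W :: "complex set" and \<pi> :: "complex \<Rightarrow> 'm"
  assumes covering: "covering_space W \<pi> M" and local_diffeo: "local_diffeo A W \<pi>"
begin

lemma proj_in: "w \<in> W \<Longrightarrow> \<pi> w \<in> M"
  using covering_space_imp_surjective[OF covering] by blast

lemma chart_around:
  assumes "x \<in> M"
  obtains c where "c \<in> charts_at A x"
  using cover assms unfolding charts_at_def by blast

abbreviation proj_diff :: "'m chart \<Rightarrow> complex \<Rightarrow> complex \<Rightarrow> complex" where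
  "proj_diff c w \<equiv> frechet_derivative (snd c \<circ> \<pi>) (at w)"

lemma proj_diff:
  assumes "w \<in> W" "c \<in> charts_at A (\<pi> w)"
  shows has_derivative_proj: "((snd c \<circ> \<pi>) has_derivative proj_diff c w) (at w)"
    and linear_proj_diff: "linear (proj_diff c w)"
    and bij_proj_diff: "bij (proj_diff c w)"
proof -
  have c: "c \<in> A" "w \<in> W \<inter> \<pi> -` fst c"
    using assms by (auto simp: charts_at_def)
  with local_diffeo show *: "((snd c \<circ> \<pi>) has_derivative proj_diff c w) (at w)"
    and "bij (proj_diff c w)"
    unfolding local_diffeo_def using smooth_on_imp_C1(1) by blast+
  from * show "linear (proj_diff c w)"
    using has_derivative_linear by blast
qed

lemma continuous_on_proj_diff:
  assumes "c \<in> A"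
  shows "continuous_on (W \<inter> \<pi> -` fst c) (\<lambda>w. proj_diff c w v)"
  using assms local_diffeo smooth_on_imp_C1(2) unfolding local_diffeo_def by blast

lemma tangent_norm_pos:
  assumes "x \<in> M" "\<And>c. c \<in> charts_at A x \<Longrightarrow> \<xi> c \<noteq> 0"
  shows "0 < tangent_norm A g x \<xi>"
proof -
  define c where "c = (SOME c. c \<in> charts_at A x)"
  have "c \<in> charts_at A x"
    unfolding c_def using chart_around[OF assms(1)] by (metis someI)
  then have "0 < g c (snd c x) (\<xi> c) (\<xi> c)"
    using assms(2)[of c] metric_pos[of c "snd c x" "\<xi> c"] by (simp add: charts_at_def)
  then show ?thesis
    unfolding tangent_norm_def tangent_inner_def Let_def c_def[symmetric] by simp
qed

lemma tangent_norm_scale: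
  assumes "x \<in> M" "0 < l" "\<And>c. c \<in> charts_at A x \<Longrightarrow> \<xi> c = l *\<^sub>R \<eta> c"
  shows "tangent_norm A g x \<xi> = l * tangent_norm A g x \<eta>"
proof -
  define c where "c = (SOME c. c \<in> charts_at A x)"
  have c: "c \<in> charts_at A x"
    unfolding c_def using chart_around[OF assms(1)] by (metis someI)
  then have "bilinear (g c (snd c x))"
    by (intro metric_bilinear) (auto simp: charts_at_def)
  then have "g c (snd c x) (\<xi> c) (\<xi> c) = l\<^sup>2 * g c (snd c x) (\<eta> c) (\<eta> c)"
    unfolding assms(3)[OF c] by (simp add: bilinear_lmul bilinear_rmul power2_eq_square)
  then show ?thesis
    using assms(2) unfolding tangent_norm_def tangent_inner_def Let_def c_def[symmetric]
    by (simp add: real_sqrt_mult)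
qed

text \<open>Equality of unit vectors is freed from the metric: it says that the velocities are positive multiples of each
other. In this form it passes to lifts.\<close>

lemma direction_eq_iff:
  assumes x: "x \<in> M" "\<gamma> u = x" "\<delta> s = x"
    and nz: "\<And>c. c \<in> charts_at A x \<Longrightarrow> velocity A a b \<gamma> u c \<noteq> 0"
      "\<And>c. c \<in> charts_at A x \<Longrightarrow> velocity A a' b' \<delta> s c \<noteq> 0"
  shows "direction A g a b \<gamma> u = direction A g a' b' \<delta> s \<longleftrightarrow>
    (\<exists>l>0. \<forall>c\<in>charts_at A x. velocity A a b \<gamma> u c = l *\<^sub>R velocity A a' b' \<delta> s c)"
    (is "?L \<longleftrightarrow> ?R")
proof -
  let ?v = "velocity A a b \<gamma> u" and ?w = "velocity A a' b' \<delta> s"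
  let ?n = "tangent_norm A g x"
  have pos: "0 < ?n ?v" "0 < ?n ?w"
    using tangent_norm_pos x(1) nz by blast+
  have "?L \<longleftrightarrow> (\<forall>c\<in>charts_at A x. ?v c /\<^sub>R ?n ?v = ?w c /\<^sub>R ?n ?w)"
    unfolding direction_def x(2,3) by (auto simp: restrict_def fun_eq_iff)
  also have "\<dots> \<longleftrightarrow> ?R"
  proof
    assume *: "\<forall>c\<in>charts_at A x. ?v c /\<^sub>R ?n ?v = ?w c /\<^sub>R ?n ?w"
    have "?v c = (?n ?v / ?n ?w) *\<^sub>R ?w c" if "c \<in> charts_at A x" for c
    proof -
      have "?v c = ?n ?v *\<^sub>R (?v c /\<^sub>R ?n ?v)"
        using pos by simp
      also have "\<dots> = (?n ?v / ?n ?w) *\<^sub>R ?w c"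
        using * that by (simp add: divide_inverse)
      finally show ?thesis .
    qed
    then show ?R
      using pos by (intro exI[of _ "?n ?v / ?n ?w"]) auto
  next
    assume ?R
    then obtain l where l: "0 < l" "\<And>c. c \<in> charts_at A x \<Longrightarrow> ?v c = l *\<^sub>R ?w c"
      by blast
    have "?n ?v = l * ?n ?w"
      using tangent_norm_scale[of x l ?v ?w] x(1) l by blast
    then show "\<forall>c\<in>charts_at A x. ?v c /\<^sub>R ?n ?v = ?w c /\<^sub>R ?n ?w"
      using l pos by simp
  qed
  finally show ?thesis .
qed

lemma chart_has_vector_derivative:
  assumes "a < b" "u \<in> {a..b}" and \<kappa>: "(\<kappa> has_vector_derivative x) (at u within {a..b})" "\<kappa> u \<in> W"
    and \<gamma>: "\<And>s. s \<in> {a..b} \<Longrightarrow> \<gamma> s = \<pi> (\<kappa> s)" and c: "c \<in> charts_at A (\<gamma> u)"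
  shows "((snd c \<circ> \<gamma>) has_vector_derivative proj_diff c (\<kappa> u) x) (at u within {a..b})"
    and "velocity A a b \<gamma> u c = proj_diff c (\<kappa> u) x"
proof -
  have c': "c \<in> charts_at A (\<pi> (\<kappa> u))"
    using c \<gamma> assms(2) by simp
  have "((\<lambda>s. (snd c \<circ> \<pi>) (\<kappa> s)) has_derivative (\<lambda>s. proj_diff c (\<kappa> u) (s *\<^sub>R x))) (at u within {a..b})"
    using has_derivative_compose[OF \<kappa>(1)[unfolded has_vector_derivative_def]
        has_derivative_proj[OF \<kappa>(2) c']] .
  then have "((\<lambda>s. (snd c \<circ> \<pi>) (\<kappa> s)) has_vector_derivative proj_diff c (\<kappa> u) x) (at u within {a..b})"
    by (simp add: has_vector_derivative_def linear_scale[OF linear_proj_diff[OF \<kappa>(2) c']])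
  then show *: "((snd c \<circ> \<gamma>) has_vector_derivative proj_diff c (\<kappa> u) x) (at u within {a..b})"
    by (rule has_vector_derivative_transform[OF assms(2), rotated]) (simp add: \<gamma>)
  show "velocity A a b \<gamma> u c = proj_diff c (\<kappa> u) x"
    using vector_derivative_within_closed_interval[OF assms(1,2) *] c by (simp add: velocity_def)
qed

lemma lift_has_vector_derivative:
  assumes C1: "C1_curve M A a b \<gamma>" and lift: "is_lift W \<pi> a b \<gamma> \<kappa>" and u: "u \<in> {a..b}"
  shows "(\<kappa> has_vector_derivative vector_derivative \<kappa> (at u within {a..b})) (at u within {a..b})"
proof -
  have \<kappa>: "continuous_on {a..b} \<kappa>" "\<kappa> u \<in> W" "\<And>s. s \<in> {a..b} \<Longrightarrow> \<pi> (\<kappa> s) = \<gamma> s"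
    using lift u by (auto simp: is_lift_def)
  obtain c where c: "c \<in> charts_at A (\<pi> (\<kappa> u))"
    using chart_around proj_in \<kappa>(2) by blast
  then have "(snd c \<circ> \<gamma>) differentiable (at u within {a..b})"
    using C1 u \<kappa>(3)[OF u] by (simp add: C1_curve_def charts_at_def)
  then obtain w where w: "((snd c \<circ> \<gamma>) has_vector_derivative w) (at u within {a..b})"
    using vector_derivative_works by blast
  have w': "((\<lambda>s. (snd c \<circ> \<pi>) (\<kappa> s)) has_vector_derivative w) (at u within {a..b})"
    by (rule has_vector_derivative_transform[OF u _ w]) (simp add: \<kappa>(3))
  have "continuous (at u within {a..b}) \<kappa>"
    using \<kappa>(1) u by (simp add: continuous_on_eq_continuous_within)
  from has_vector_derivative_lift[OF has_derivative_proj[OF \<kappa>(2) c] bij_proj_diff[OF \<kappa>(2) c] this w']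
  have "\<kappa> differentiable (at u within {a..b})"
    by (rule differentiableI_vector)
  then show ?thesis
    by (simp add: vector_derivative_works)
qed

lemma continuous_on_proj_diff_apply:
  assumes k: "continuous_on T k" "k ` T \<subseteq> W" and X: "continuous_on T X" and c: "c \<in> A"
  shows "continuous_on {z \<in> T. \<pi> (k z) \<in> fst c} (\<lambda>z. proj_diff c (k z) (X z))"
proof (rule continuous_on_linear_family_apply[where D = "\<lambda>z. proj_diff c (k z)"])
  show "continuous_on {z \<in> T. \<pi> (k z) \<in> fst c} (\<lambda>z. proj_diff c (k z) v)" for v
    by (rule continuous_on_compose2[OF continuous_on_proj_diff[OF c]])
       (use k in \<open>auto intro: continuous_on_subset\<close>)
  show "continuous_on {z \<in> T. \<pi> (k z) \<in> fst c} X"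
    using X by (rule continuous_on_subset) auto
  show "linear (proj_diff c (k z))" if "z \<in> {z \<in> T. \<pi> (k z) \<in> fst c}" for z
    using that k(2) c by (intro linear_proj_diff) (auto simp: charts_at_def)
qed

text \<open>Local version of Cramer's rule for lifts: near each point one chart suffices, because its preimage is open
in the parameter space.\<close>

lemma continuous_on_proj_diff_cancel:
  fixes k :: "'z::t2_space \<Rightarrow> complex"
  assumes k: "continuous_on T k" "k ` T \<subseteq> W"
    and Y: "\<And>c. c \<in> A \<Longrightarrow> continuous_on {z \<in> T. \<pi> (k z) \<in> fst c} (\<lambda>z. proj_diff c (k z) (X z))"
  shows "continuous_on T X"
  unfolding continuous_on_eq_continuous_within
proof
  fix z assume z: "z \<in> T"
  then obtain c where c: "c \<in> charts_at A (\<pi> (k z))"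
    using chart_around proj_in k(2) by blast
  let ?T = "{z \<in> T. \<pi> (k z) \<in> fst c}"
  have "continuous_on ?T X"
  proof (rule continuous_on_linear_family_cancel[where D = "\<lambda>z. proj_diff c (k z)"])
    show "continuous_on ?T (\<lambda>z. proj_diff c (k z) (X z))"
      using Y c by (simp add: charts_at_def)
    show "continuous_on ?T (\<lambda>z. proj_diff c (k z) v)" for v
      using continuous_on_proj_diff_apply[OF k continuous_on_const] c by (simp add: charts_at_def)
    fix z assume "z \<in> ?T"
    then have "k z \<in> W" "c \<in> charts_at A (\<pi> (k z))"
      using k(2) c by (auto simp: charts_at_def)
    then show "linear (proj_diff c (k z))" "inj (proj_diff c (k z))"
      using linear_proj_diff bij_proj_diff bij_is_inj by blast+
  qed
  moreover have "z \<in> ?T"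
    using z c by (simp add: charts_at_def)
  ultimately have "continuous (at z within ?T) X"
    by (simp add: continuous_on_eq_continuous_within)
  moreover have "openin (top_of_set T) ?T"
  proof -
    have "openin (top_of_set M) (fst c)"
      using chart c by (simp add: is_chart_def charts_at_def)
    moreover have "continuous_on T (\<lambda>z. \<pi> (k z))"
      by (rule continuous_on_compose2[OF covering_space_imp_continuous[OF covering] k])
    moreover have "(\<lambda>z. \<pi> (k z)) \<in> T \<rightarrow> M"
      using k(2) proj_in by blast
    ultimately have "openin (top_of_set T) (T \<inter> (\<lambda>z. \<pi> (k z)) -` fst c)"
      by (simp add: continuous_openin_preimage)
    moreover have "T \<inter> (\<lambda>z. \<pi> (k z)) -` fst c = ?T"
      by auto
    ultimately show ?thesis by simp
  qed
  then obtain U where U: "open U" "?T = T \<inter> U"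
    by (auto simp: openin_open)
  then have "at z within T = at z within ?T"
    using \<open>z \<in> ?T\<close> by (intro at_within_nhd[of z U]) auto
  ultimately show "continuous (at z within T) X"
    by simp
qed

lemma continuous_on_velocity_project:
  assumes "a < b" and k: "continuous_on (T \<times> {a..b}) (\<lambda>(t, u). k t u)"
      "\<And>t u. t \<in> T \<Longrightarrow> u \<in> {a..b} \<Longrightarrow> k t u \<in> W"
    and X: "continuous_on (T \<times> {a..b}) (\<lambda>(t, u). X t u)"
      "\<And>t u. t \<in> T \<Longrightarrow> u \<in> {a..b} \<Longrightarrow> (k t has_vector_derivative X t u) (at u within {a..b})"
    and \<sigma>: "\<And>t u. t \<in> T \<Longrightarrow> u \<in> {a..b} \<Longrightarrow> \<sigma> t u = \<pi> (k t u)" and c: "c \<in> A"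
  shows "continuous_on {(t, u). t \<in> T \<and> u \<in> {a..b} \<and> \<sigma> t u \<in> fst c} (\<lambda>(t, u). velocity A a b (\<sigma> t) u c)"
proof (rule continuous_on_eq)
  let ?S = "{(t, u). t \<in> T \<and> u \<in> {a..b} \<and> \<sigma> t u \<in> fst c}"
  have "?S = {z \<in> T \<times> {a..b}. \<pi> ((\<lambda>(t, u). k t u) z) \<in> fst c}"
    using \<sigma> by auto
  then show "continuous_on ?S (\<lambda>z. proj_diff c ((\<lambda>(t, u). k t u) z) ((\<lambda>(t, u). X t u) z))"
    using continuous_on_proj_diff_apply[OF k(1) _ X(1) c] k(2) by (auto simp: image_subset_iff)
  fix z assume "z \<in> ?S"
  then obtain t u where z: "z = (t, u)" "t \<in> T" "u \<in> {a..b}" "\<sigma> t u \<in> fst c"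
    by auto
  show "proj_diff c ((\<lambda>(t, u). k t u) z) ((\<lambda>(t, u). X t u) z) = (\<lambda>(t, u). velocity A a b (\<sigma> t) u c) z"
    using chart_has_vector_derivative(2)[OF assms(1) z(3) X(2)[OF z(2,3)] k(2)[OF z(2,3)] \<sigma>[OF z(2)]]
      z c by (simp add: charts_at_def)
qed

lemma regular_curve_project:
  assumes "a < b" and \<kappa>: "\<And>u. u \<in> {a..b} \<Longrightarrow> \<kappa> u \<in> W"
    and X: "continuous_on {a..b} X" "\<And>u. u \<in> {a..b} \<Longrightarrow> X u \<noteq> 0"
      "\<And>u. u \<in> {a..b} \<Longrightarrow> (\<kappa> has_vector_derivative X u) (at u within {a..b})"
    and \<gamma>: "\<And>u. u \<in> {a..b} \<Longrightarrow> \<gamma> u = \<pi> (\<kappa> u)"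
  shows "regular_curve M A a b \<gamma>"
proof -
  note deriv = chart_has_vector_derivative[OF assms(1) _ X(3) \<kappa> \<gamma>]
  have \<kappa>_cont: "continuous_on {a..b} \<kappa>"
    using X(3) by (meson continuous_on_eq_continuous_within has_vector_derivative_continuous)
  have \<kappa>_sub: "\<kappa> ` {a..b} \<subseteq> W"
    using \<kappa> by auto
  have "continuous_on {a..b} (\<lambda>u. \<pi> (\<kappa> u))"
    by (rule continuous_on_compose2[OF covering_space_imp_continuous[OF covering] \<kappa>_cont]) (use \<kappa> in auto)
  then have "continuous_on {a..b} \<gamma>"
    by (rule continuous_on_eq) (simp add: \<gamma>)
  moreover have "\<gamma> ` {a..b} \<subseteq> M"
    using \<gamma> \<kappa> proj_in by auto
  moreover have "continuous_on {u \<in> {a..b}. \<gamma> u \<in> fst c} (\<lambda>u. velocity A a b \<gamma> u c)" if c: "c \<in> A" for c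
  proof (rule continuous_on_eq)
    have "{u \<in> {a..b}. \<gamma> u \<in> fst c} = {u \<in> {a..b}. \<pi> (\<kappa> u) \<in> fst c}"
      using \<gamma> by auto
    then show "continuous_on {u \<in> {a..b}. \<gamma> u \<in> fst c} (\<lambda>u. proj_diff c (\<kappa> u) (X u))"
      using continuous_on_proj_diff_apply[OF \<kappa>_cont \<kappa>_sub X(1) c] by (simp only:)
    show "proj_diff c (\<kappa> u) (X u) = velocity A a b \<gamma> u c" if "u \<in> {u \<in> {a..b}. \<gamma> u \<in> fst c}" for u
      by (rule deriv(2)[symmetric]) (use that c in \<open>auto simp: charts_at_def\<close>)
  qed
  moreover have "(snd c \<circ> \<gamma>) differentiable (at u within {a..b})"
    if "c \<in> A" "u \<in> {a..b}" "\<gamma> u \<in> fst c" for c u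
    by (rule differentiableI_vector[OF deriv(1)]) (use that in \<open>auto simp: charts_at_def\<close>)
  moreover have "velocity A a b \<gamma> u c \<noteq> 0" if u: "u \<in> {a..b}" and c: "c \<in> charts_at A (\<gamma> u)" for u c
  proof
    assume 0: "velocity A a b \<gamma> u c = 0"
    have "velocity A a b \<gamma> u c = proj_diff c (\<kappa> u) (X u)"
      by (rule deriv(2)) (use u c in auto)
    then have "proj_diff c (\<kappa> u) (X u) = proj_diff c (\<kappa> u) 0"
      using 0 u c linear_0[OF linear_proj_diff[of "\<kappa> u" c]] \<kappa> \<gamma> by simp
    moreover have "inj (proj_diff c (\<kappa> u))"
      using bij_proj_diff[of "\<kappa> u" c] \<kappa> \<gamma> u c bij_is_inj by simp
    ultimately show False
      using X(2)[OF u] by (simp add: inj_eq)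
  qed
  ultimately show ?thesis
    using assms(1) unfolding regular_curve_def C1_curve_def by blast
qed

lemma lift_velocity:
  assumes reg: "regular_curve M A a b \<gamma>" and lift: "is_lift W \<pi> a b \<gamma> \<kappa>"
  defines "X \<equiv> \<lambda>u. vector_derivative \<kappa> (at u within {a..b})"
  shows "\<And>u. u \<in> {a..b} \<Longrightarrow> (\<kappa> has_vector_derivative X u) (at u within {a..b})"
    and "\<And>u c. u \<in> {a..b} \<Longrightarrow> c \<in> charts_at A (\<gamma> u) \<Longrightarrow> velocity A a b \<gamma> u c = proj_diff c (\<kappa> u) (X u)"
    and "\<And>u. u \<in> {a..b} \<Longrightarrow> X u \<noteq> 0"
    and "continuous_on {a..b} X"
proof -
  have C1: "C1_curve M A a b \<gamma>" and ab: "a < b"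
    using reg by (auto simp: regular_curve_def C1_curve_def)
  have \<kappa>: "continuous_on {a..b} \<kappa>" "\<kappa> ` {a..b} \<subseteq> W" "\<And>u. u \<in> {a..b} \<Longrightarrow> \<gamma> u = \<pi> (\<kappa> u)"
    using lift by (auto simp: is_lift_def)
  show deriv: "(\<kappa> has_vector_derivative X u) (at u within {a..b})" if "u \<in> {a..b}" for u
    unfolding X_def by (rule lift_has_vector_derivative[OF C1 lift that])
  show vel: "velocity A a b \<gamma> u c = proj_diff c (\<kappa> u) (X u)"
    if "u \<in> {a..b}" "c \<in> charts_at A (\<gamma> u)" for u c
    by (rule chart_has_vector_derivative(2)[OF ab that(1) deriv[OF that(1)]]) (use \<kappa> that in auto)
  show "X u \<noteq> 0" if u: "u \<in> {a..b}" for u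
  proof
    assume 0: "X u = 0"
    have u': "\<gamma> u = \<pi> (\<kappa> u)" "\<kappa> u \<in> W"
      using \<kappa> u by auto
    then obtain c where c: "c \<in> charts_at A (\<gamma> u)"
      using chart_around proj_in by metis
    have "velocity A a b \<gamma> u c = 0"
      using vel[OF u c] 0 linear_0[OF linear_proj_diff[of "\<kappa> u" c]] u' c by simp
    then show False
      using reg u c by (simp add: regular_curve_def)
  qed
  show "continuous_on {a..b} X"
  proof (rule continuous_on_proj_diff_cancel[OF \<kappa>(1,2)])
    fix c assume c: "c \<in> A"
    show "continuous_on {u \<in> {a..b}. \<pi> (\<kappa> u) \<in> fst c} (\<lambda>u. proj_diff c (\<kappa> u) (X u))"
    proof (rule continuous_on_eq)
      have "{u \<in> {a..b}. \<pi> (\<kappa> u) \<in> fst c} = {u \<in> {a..b}. \<gamma> u \<in> fst c}"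
        using \<kappa>(3) by auto
      then show "continuous_on {u \<in> {a..b}. \<pi> (\<kappa> u) \<in> fst c} (\<lambda>u. velocity A a b \<gamma> u c)"
        using C1 c by (simp add: C1_curve_def)
      show "velocity A a b \<gamma> u c = proj_diff c (\<kappa> u) (X u)"
        if "u \<in> {u \<in> {a..b}. \<pi> (\<kappa> u) \<in> fst c}" for u
        using vel[of u c] that c \<kappa>(3) by (simp add: charts_at_def)
    qed
  qed
qed

text \<open>For lifts through the same point, equal directions on \<open>M\<close> are equal directions in the plane, as the differential of
the projection is injective there.\<close>

lemma direction_eq_iff_lift:
  assumes reg: "regular_curve M A a b \<gamma>" "regular_curve M A a' b' \<delta>"
    and lift: "is_lift W \<pi> a b \<gamma> \<kappa>" "is_lift W \<pi> a' b' \<delta> \<nu>"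
    and u: "u \<in> {a..b}" "s \<in> {a'..b'}" and eq: "\<kappa> u = \<nu> s"
  shows "direction A g a b \<gamma> u = direction A g a' b' \<delta> s \<longleftrightarrow>
    (\<exists>l>0. vector_derivative \<kappa> (at u within {a..b}) = l *\<^sub>R vector_derivative \<nu> (at s within {a'..b'}))"
    (is "_ \<longleftrightarrow> (\<exists>l>0. ?X = l *\<^sub>R ?Y)")
proof -
  have W: "\<kappa> u \<in> W" "\<gamma> u = \<pi> (\<kappa> u)"
    using lift(1) u(1) by (auto simp: is_lift_def)
  have W': "\<delta> s = \<pi> (\<kappa> u)"
    using lift(2) u(2) unfolding eq by (auto simp: is_lift_def)
  have nz: "velocity A a b \<gamma> u c \<noteq> 0" "velocity A a' b' \<delta> s c \<noteq> 0" if "c \<in> charts_at A (\<pi> (\<kappa> u))" for c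
    using reg u W W' that by (auto simp: regular_curve_def)
  have vel: "velocity A a b \<gamma> u c = proj_diff c (\<kappa> u) ?X" "velocity A a' b' \<delta> s c = proj_diff c (\<kappa> u) ?Y"
    if "c \<in> charts_at A (\<pi> (\<kappa> u))" for c
    using lift_velocity(2)[OF reg(1) lift(1) u(1)] lift_velocity(2)[OF reg(2) lift(2) u(2)] W W' that eq
    by simp_all
  have scale: "proj_diff c (\<kappa> u) ?X = l *\<^sub>R proj_diff c (\<kappa> u) ?Y \<longleftrightarrow> ?X = l *\<^sub>R ?Y"
    if "c \<in> charts_at A (\<pi> (\<kappa> u))" for c l
    using inj_eq[OF bij_is_inj[OF bij_proj_diff[OF W(1) that]]] linear_scale[OF linear_proj_diff[OF W(1) that]]
    by metis
  have "direction A g a b \<gamma> u = direction A g a' b' \<delta> s \<longleftrightarrow>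
    (\<exists>l>0. \<forall>c\<in>charts_at A (\<pi> (\<kappa> u)). velocity A a b \<gamma> u c = l *\<^sub>R velocity A a' b' \<delta> s c)"
    using direction_eq_iff[OF proj_in[OF W(1)] W(2) W' nz] by simp
  also have "\<dots> \<longleftrightarrow> (\<exists>l>0. \<forall>c\<in>charts_at A (\<pi> (\<kappa> u)). ?X = l *\<^sub>R ?Y)"
    by (simp add: vel scale cong: ball_cong)
  also have "\<dots> \<longleftrightarrow> (\<exists>l>0. ?X = l *\<^sub>R ?Y)"
    using chart_around[OF proj_in[OF W(1)]] by blast
  finally show ?thesis .
qed

end

section \<open>Angle functions, the index and reparametrization\<close>

text \<open>The values of \<open>\<phi>\<close> lie in a translate of the discrete set \<open>2\<pi>\<int>\<close>.\<close>

lemma cis_eq_imp_const: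
  fixes \<phi> :: "'a::topological_space \<Rightarrow> real"
  assumes "connected S" "continuous_on S \<phi>" "\<And>x. x \<in> S \<Longrightarrow> cis (\<phi> x) = c"
    and "x \<in> S" "y \<in> S"
  shows "\<phi> x = \<phi> y"
proof -
  have "2 * pi \<le> norm (\<phi> y - \<phi> x)" if "x \<in> S" "y \<in> S" "\<phi> y \<noteq> \<phi> x" for x y
  proof -
    have "cis (\<phi> y) = cis (\<phi> x)"
      using assms(3) that by simp
    then obtain n :: int where n: "\<phi> y = \<phi> x + 2 * pi * n"
      using sin_cos_eq_iff[of "\<phi> y" "\<phi> x"] by (auto simp: complex_eq_iff)
    then have "1 \<le> \<bar>n\<bar>"
      using that by auto
    then have "2 * pi * 1 \<le> 2 * pi * \<bar>real_of_int n\<bar>"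
      by (intro mult_left_mono) auto
    then show ?thesis
      using n by (simp add: abs_mult)
  qed
  then have "\<phi> constant_on S"
    by (intro continuous_discrete_range_constant assms(1,2)) (metis mult_pos_pos pi_gt_zero zero_less_numeral)
  then show ?thesis
    using assms(4,5) by (auto simp: constant_on_def)
qed

lemma continuous_polar_form:
  fixes v :: "'a::real_normed_vector \<Rightarrow> complex"
  assumes "continuous_on S v" "contractible S" "\<And>z. z \<in> S \<Longrightarrow> v z \<noteq> 0"
  obtains \<theta> where "continuous_on S \<theta>" "\<And>z. z \<in> S \<Longrightarrow> v z = norm (v z) *\<^sub>R cis (\<theta> z)"
proof -
  obtain l where l: "continuous_on S l" "\<And>z. z \<in> S \<Longrightarrow> v z = exp (l z)"
    using continuous_logarithm_on_contractible[OF assms] by blast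
  have "v z = norm (v z) *\<^sub>R cis (Im (l z))" if "z \<in> S" for z
    using l(2)[OF that] by (simp add: exp_eq_polar norm_mult scaleR_conv_of_real)
  then show thesis
    using l(1) by (intro that[of "\<lambda>z. Im (l z)"] continuous_intros)
qed

lemma polar_cis:
  assumes "0 < r" "x = r *\<^sub>R cis \<alpha>"
  shows "x /\<^sub>R norm x = cis \<alpha>"
  using assms by simp

lemma direction_scaleR:
  fixes x :: "'a::real_normed_vector"
  assumes "0 < l"
  shows "(l *\<^sub>R x) /\<^sub>R norm (l *\<^sub>R x) = x /\<^sub>R norm x"
  using sgn_scaleR[of l x] assms unfolding sgn_div_norm by simp

lemma angle_functionI:
  assumes "a < b" "continuous_on {a..b} \<theta>"
    and "\<And>u. u \<in> {a..b} \<Longrightarrow> (\<gamma> has_vector_derivative v u) (at u within {a..b})"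
    and "\<And>u. u \<in> {a..b} \<Longrightarrow> v u \<noteq> 0" "\<And>u. u \<in> {a..b} \<Longrightarrow> v u = norm (v u) *\<^sub>R cis (\<theta> u)"
  shows "angle_function a b \<gamma> \<theta>"
proof -
  have "vector_derivative \<gamma> (at u within {a..b}) = v u" if "u \<in> {a..b}" for u
    using vector_derivative_within_closed_interval[OF assms(1) that assms(3)[OF that]] .
  moreover have "v u /\<^sub>R norm (v u) = cis (\<theta> u)" if "u \<in> {a..b}" for u
    using assms(4,5)[OF that] polar_cis by (metis zero_less_norm_iff)
  ultimately show ?thesis
    using assms(2) by (simp add: angle_function_def)
qed

text \<open>Any two angle functions differ by a constant, which makes the defining description unique.\<close>

lemma i_index_eq:
  assumes "a \<le> b" "angle_function a b \<gamma> \<theta>"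
  shows "i_index a b \<gamma> = (\<theta> b - \<theta> a) / (2 * pi)"
  unfolding i_index_def
proof (rule the_equality)
  show "\<exists>\<theta>'. angle_function a b \<gamma> \<theta>' \<and> (\<theta> b - \<theta> a) / (2 * pi) = (\<theta>' b - \<theta>' a) / (2 * pi)"
    using assms(2) by blast
  fix i assume "\<exists>\<theta>'. angle_function a b \<gamma> \<theta>' \<and> i = (\<theta>' b - \<theta>' a) / (2 * pi)"
  then obtain \<theta>' where \<theta>': "angle_function a b \<gamma> \<theta>'" "i = (\<theta>' b - \<theta>' a) / (2 * pi)"
    by blast
  have "\<theta>' b - \<theta> b = \<theta>' a - \<theta> a"
  proof (rule cis_eq_imp_const[of "{a..b}" "\<lambda>u. \<theta>' u - \<theta> u" 1])
    show "continuous_on {a..b} (\<lambda>u. \<theta>' u - \<theta> u)"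
      using assms(2) \<theta>'(1) by (auto simp: angle_function_def intro!: continuous_intros)
    show "cis (\<theta>' u - \<theta> u) = 1" if "u \<in> {a..b}" for u
      using assms(2) \<theta>'(1) that by (simp add: angle_function_def flip: cis_divide)
  qed (use assms(1) in auto)
  then show "i = (\<theta> b - \<theta> a) / (2 * pi)"
    using \<theta>'(2) by (simp add: algebra_simps)
qed

lemma reparametrization_map_into:
  assumes h: "h c = a" "h d = b"
    "\<And>u. u \<in> {c..d} \<Longrightarrow> (h has_real_derivative h' u) (at u within {c..d})"
    "\<And>u. u \<in> {c..d} \<Longrightarrow> 0 < h' u"
    and u: "u \<in> {c..d}"
  shows "h u \<in> {a..b}"
proof -
  have mono: "h x \<le> h y" if "c \<le> x" "x \<le> y" "y \<le> d" for x y
  proof -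
    have "(h has_derivative (*) (h' z)) (at z within {x..y})" if "x \<le> z" "z \<le> y" for z
    proof -
      have "(h has_real_derivative h' z) (at z within {x..y})"
        by (rule DERIV_subset[OF h(3)]) (use that \<open>c \<le> x\<close> \<open>y \<le> d\<close> in auto)
      then show ?thesis
        by (simp add: has_field_derivative_def)
    qed
    from mvt_very_simple[OF \<open>x \<le> y\<close> this]
    obtain z where z: "z \<in> {x..y}" "h y - h x = h' z * (y - x)"
      by blast
    have "0 \<le> h' z * (y - x)"
      using h(4)[of z] z(1) that by (intro mult_nonneg_nonneg) auto
    then show ?thesis
      using z(2) by simp
  qed
  show ?thesis
    using mono[of c u] mono[of u d] u h(1,2) by auto
qed

lemma has_vector_derivative_reparametrization:
  assumes h: "(h has_real_derivative h') (at u within {c..d})" "h ` {c..d} \<subseteq> {a..b}" "u \<in> {c..d}"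
    and \<kappa>: "(\<kappa> has_vector_derivative x) (at (h u) within {a..b})"
    and \<delta>: "\<And>s. s \<in> {c..d} \<Longrightarrow> \<delta> s = \<kappa> (h s)"
  shows "(\<delta> has_vector_derivative h' *\<^sub>R x) (at u within {c..d})"
proof -
  have "((\<kappa> \<circ> h) has_vector_derivative h' *\<^sub>R x) (at u within {c..d})"
    using vector_diff_chain_within[OF _ has_vector_derivative_within_subset[OF \<kappa> h(2)]] h(1)
    by (simp add: has_real_derivative_iff_has_vector_derivative)
  then show ?thesis
    by (rule has_vector_derivative_transform[OF h(3), rotated]) (simp add: \<delta>)
qed

lemma i_index_reparametrization:
  assumes "c < d" "a < b"
    and h: "h c = a" "h d = b"
    "\<And>u. u \<in> {c..d} \<Longrightarrow> (h has_real_derivative h' u) (at u within {c..d})"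
    "\<And>u. u \<in> {c..d} \<Longrightarrow> 0 < h' u"
    and X: "continuous_on {a..b} X" "\<And>u. u \<in> {a..b} \<Longrightarrow> X u \<noteq> 0"
      "\<And>u. u \<in> {a..b} \<Longrightarrow> (\<kappa> has_vector_derivative X u) (at u within {a..b})"
    and \<delta>: "\<And>u. u \<in> {c..d} \<Longrightarrow> \<delta> u = \<kappa> (h u)"
  shows "i_index c d \<delta> = i_index a b \<kappa>"
proof -
  have into: "h u \<in> {a..b}" if "u \<in> {c..d}" for u
    using reparametrization_map_into[OF h that] .
  obtain \<theta> where \<theta>: "continuous_on {a..b} \<theta>" "\<And>u. u \<in> {a..b} \<Longrightarrow> X u = norm (X u) *\<^sub>R cis (\<theta> u)"
    using continuous_polar_form[OF X(1) _ X(2)] convex_imp_contractible[OF convex_closed_interval] by blast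
  have "angle_function a b \<kappa> \<theta>"
    using angle_functionI[OF \<open>a < b\<close> \<theta>(1) X(3,2) \<theta>(2)] .
  moreover have "angle_function c d \<delta> (\<lambda>u. \<theta> (h u))"
  proof (rule angle_functionI[OF \<open>c < d\<close>])
    have "continuous_on {c..d} h"
      using h(3) by (meson DERIV_continuous continuous_on_eq_continuous_within)
    then show "continuous_on {c..d} (\<lambda>u. \<theta> (h u))"
      by (rule continuous_on_compose2[OF \<theta>(1)]) (use into in auto)
    fix u assume u: "u \<in> {c..d}"
    show "(\<delta> has_vector_derivative h' u *\<^sub>R X (h u)) (at u within {c..d})"
      by (rule has_vector_derivative_reparametrization[OF h(3)[OF u] _ u X(3)[OF into[OF u]] \<delta>])
         (use into in auto)
    show "h' u *\<^sub>R X (h u) \<noteq> 0"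
      using h(4)[OF u] X(2)[OF into[OF u]] by simp
    have "h' u *\<^sub>R X (h u) = h' u *\<^sub>R (norm (X (h u)) *\<^sub>R cis (\<theta> (h u)))"
      using \<theta>(2)[OF into[OF u]] by simp
    then show "h' u *\<^sub>R X (h u) = norm (h' u *\<^sub>R X (h u)) *\<^sub>R cis (\<theta> (h u))"
      using h(4)[OF u] by simp
  qed
  ultimately show ?thesis
    using i_index_eq \<open>a < b\<close> \<open>c < d\<close> h(1,2) by (simp add: less_imp_le)
qed

lemma unit_path_affine_in: "a \<le> b \<Longrightarrow> s \<in> {0..1} \<Longrightarrow> a + s * (b - a) \<in> {a..b}" for a b s :: real
  using mult_left_le_one_le[of "b - a" s] by auto

lemma path_unit_path:
  assumes "a \<le> b" "continuous_on {a..b} \<gamma>" "\<gamma> ` {a..b} \<subseteq> M"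
  shows "path (unit_path a b \<gamma>)" "path_image (unit_path a b \<gamma>) \<subseteq> M"
proof -
  show "path (unit_path a b \<gamma>)"
    unfolding path_def unit_path_def
    by (rule continuous_on_compose2[OF assms(2)])
       (use unit_path_affine_in[OF assms(1)] in \<open>auto intro!: continuous_intros\<close>)
  show "path_image (unit_path a b \<gamma>) \<subseteq> M"
    unfolding path_image_def unit_path_def using unit_path_affine_in[OF assms(1)] assms(3) by blast
qed

lemma homotopic_paths_reparametrization:
  assumes "a < b" "c < d" "continuous_on {a..b} \<gamma>" "\<gamma> ` {a..b} \<subseteq> M"
    and "reparametrization a b \<gamma> c d \<delta>"
  shows "homotopic_paths M (unit_path a b \<gamma>) (unit_path c d \<delta>)"
proof -
  obtain h h' where h: "h c = a" "h d = b"
    "\<And>u. u \<in> {c..d} \<Longrightarrow> (h has_real_derivative h' u) (at u within {c..d})"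
    "\<And>u. u \<in> {c..d} \<Longrightarrow> 0 < h' u" and \<delta>: "\<And>u. u \<in> {c..d} \<Longrightarrow> \<delta> u = \<gamma> (h u)"
    using assms(5) unfolding reparametrization_def by blast
  define f where "f s = (h (c + s * (d - c)) - a) / (b - a)" for s
  have h_cont: "continuous_on {c..d} h"
    using h(3) by (meson DERIV_continuous continuous_on_eq_continuous_within)
  have in_cd: "c + s * (d - c) \<in> {c..d}" if "s \<in> {0..1}" for s
    using unit_path_affine_in[of c d s] assms(2) that by simp
  have in_ab: "h (c + s * (d - c)) \<in> {a..b}" if "s \<in> {0..1}" for s
    using reparametrization_map_into[OF h in_cd[OF that]] .
  show ?thesis
  proof (rule homotopic_paths_reparametrize)
    show "path (unit_path a b \<gamma>)" "path_image (unit_path a b \<gamma>) \<subseteq> M"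
      using path_unit_path[of a b \<gamma> M] assms by auto
    have "continuous_on {0..1} (\<lambda>s. h (c + s * (d - c)))"
      by (rule continuous_on_compose2[OF h_cont]) (use in_cd in \<open>auto intro!: continuous_intros\<close>)
    then show "continuous_on {0..1} f"
      unfolding f_def using assms(1) by (intro continuous_intros) auto
    show "f \<in> {0..1} \<rightarrow> {0..1}"
      using in_ab assms(1) by (auto simp: f_def)
    show "f 0 = 0" "f 1 = 1"
      using h(1,2) assms(1) by (simp_all add: f_def)
    show "unit_path c d \<delta> t = unit_path a b \<gamma> (f t)" if "t \<in> {0..1}" for t
      using assms(1) \<delta>[OF in_cd[OF that]] by (simp add: unit_path_def f_def)
  qed
qed

text \<open>The homotopy lifts to a homotopy which fixes the end point, and by uniqueness its first and last stage are the
given lifts.\<close>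

lemma covering_space_homotopic_lift_ends:
  fixes \<pi> :: "complex \<Rightarrow> 'b::topological_space"
  assumes cov: "covering_space W \<pi> M" and hom: "homotopic_paths M g\<^sub>1 g\<^sub>2"
    and lift: "is_lift W \<pi> 0 1 g\<^sub>1 k\<^sub>1" "is_lift W \<pi> 0 1 g\<^sub>2 k\<^sub>2" and start: "k\<^sub>1 0 = k\<^sub>2 0"
  shows "k\<^sub>1 1 = k\<^sub>2 1"
proof -
  obtain h :: "real \<times> real \<Rightarrow> 'b" where h: "continuous_on ({0..1} \<times> {0..1}) h" "h \<in> {0..1} \<times> {0..1} \<rightarrow> M"
    and sides: "\<forall>x\<in>{0..1}. h (0, x) = g\<^sub>1 x" "\<forall>x\<in>{0..1}. h (1, x) = g\<^sub>2 x"
      "\<forall>t\<in>{0..1}. pathstart (h \<circ> Pair t) = pathstart g\<^sub>1 \<and> pathfinish (h \<circ> Pair t) = pathfinish g\<^sub>1"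
    using hom unfolding homotopic_paths by blast
  note h = h bspec[OF sides(1)] bspec[OF sides(2)]
    bspec[OF sides(3), unfolded pathstart_def pathfinish_def o_def, THEN conjunct1]
    bspec[OF sides(3), unfolded pathstart_def pathfinish_def o_def, THEN conjunct2]
  have k: "continuous_on {0..1} k\<^sub>1" "k\<^sub>1 \<in> {0..1} \<rightarrow> W" "\<And>u. u \<in> {0..1} \<Longrightarrow> \<pi> (k\<^sub>1 u) = g\<^sub>1 u"
    "continuous_on {0..1} k\<^sub>2" "k\<^sub>2 \<in> {0..1} \<rightarrow> W" "\<And>u. u \<in> {0..1} \<Longrightarrow> \<pi> (k\<^sub>2 u) = g\<^sub>2 u"
    using lift by (auto simp: is_lift_def)
  obtain k where kk: "continuous_on ({0..1} \<times> {0..1}) (\<lambda>(t, u). k t u)"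
    "\<And>t u. t \<in> {0..1} \<Longrightarrow> u \<in> {0..1} \<Longrightarrow> k t u \<in> W"
    "\<And>t u. t \<in> {0..1} \<Longrightarrow> u \<in> {0..1} \<Longrightarrow> \<pi> (k t u) = h (t, u)"
    "\<And>t. t \<in> {0..1} \<Longrightarrow> k t 0 = k\<^sub>1 0" "\<And>t. t \<in> {0..1} \<Longrightarrow> k t 1 = k 0 1"
  proof (rule covering_space_lift_square[OF cov, of 0 1 "\<lambda>t u. h (t, u)" "k\<^sub>1 0" "g\<^sub>1 1"])
    show "h (t, u) \<in> M" if "t \<in> {0..1}" "u \<in> {0..1}" for t u
      using h(2) that by auto
    show "continuous_on ({0..1} \<times> {0..1}) (\<lambda>(t, u). h (t, u))"
      using h(1) by simp
    show "h (t, 0) = \<pi> (k\<^sub>1 0)" "h (t, 1) = g\<^sub>1 1" if "t \<in> {0..1}" for t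
      using h(5,6)[OF that] k(3)[of 0] by simp_all
    show "k\<^sub>1 0 \<in> W"
      using k(2) by auto
  qed (rule zero_le_one, rule that)
  have unique: "k t 1 = k' 1"
    if t: "t \<in> {0..1}" and k': "continuous_on {0..1} k'" "k' \<in> {0..1} \<rightarrow> W"
      "\<And>u. u \<in> {0..1} \<Longrightarrow> \<pi> (k' u) = h (t, u)" "k' 0 = k\<^sub>1 0" for t k'
  proof (rule covering_space_lift_unique[OF cov, where T = "{0..1}" and a = 0
      and f = "\<lambda>u. h (t, u)" and ?g1.0 = "k t" and ?g2.0 = k'])
    show "continuous_on {0..1} (\<lambda>u. h (t, u))"
      by (rule continuous_on_compose2[OF h(1)]) (use t in \<open>auto intro!: continuous_intros\<close>)
    show "continuous_on {0..1} (k t)"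
      using continuous_on_slice[OF kk(1) t] .
    show "(\<lambda>u. h (t, u)) \<in> {0..1} \<rightarrow> M"
      using h(2) t by auto
  qed (use t k' kk in auto)
  have "k 0 1 = k\<^sub>1 1"
    by (rule unique) (use k h in auto)
  moreover have "k 1 1 = k\<^sub>2 1"
    by (rule unique) (use k h start in auto)
  ultimately show ?thesis
    using kk(5)[of 1] by simp
qed

text \<open>Rescaling \<open>{0..s}\<close> to the unit interval makes the domain of integration independent of the parameters.\<close>

lemma continuous_on_indefinite_integral:
  fixes V :: "real \<Rightarrow> real \<Rightarrow> complex"
  assumes V: "continuous_on (T \<times> {0..1}) (\<lambda>(t, u). V t u)"
  shows "continuous_on (T \<times> {0..1}) (\<lambda>(t, s). integral {0..s} (V t))"
proof (rule continuous_on_eq)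
  have "continuous_on ((T \<times> {0..1}) \<times> {0..1}) (\<lambda>(z, x). V (fst z) (snd z * x))"
  proof -
    have "continuous_on ((T \<times> {0..1}) \<times> {0..1})
        (\<lambda>y. (\<lambda>(t, u). V t u) (fst (fst y), snd (fst y) * snd y))"
    proof (rule continuous_on_compose2[OF V])
      show "(\<lambda>y. (fst (fst y), snd (fst y) * snd y)) ` ((T \<times> {0..1}) \<times> {0..1}) \<subseteq> T \<times> {0..1::real}"
        by (auto intro: mult_nonneg_nonneg mult_le_one)
    qed (intro continuous_intros)
    then show ?thesis
      by (simp add: case_prod_beta)
  qed
  then have "continuous_on (T \<times> {0..1}) (\<lambda>z. integral {0..1} (\<lambda>x. V (fst z) (snd z * x)))"
    using integral_continuous_on_param[of "T \<times> {0..1}" 0 1 "\<lambda>z x. V (fst z) (snd z * x)"] by simp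
  then show "continuous_on (T \<times> {0..1}) (\<lambda>z. snd z *\<^sub>R integral {0..1} (\<lambda>x. V (fst z) (snd z * x)))"
    by (intro continuous_intros)
  fix z assume z: "z \<in> T \<times> {0..1::real}"
  obtain t s where ts: "z = (t, s)" "t \<in> T" "0 \<le> s" "s \<le> 1"
    using z by auto
  have "V t integrable_on {0..s}"
    using continuous_on_slice[OF V ts(2)] ts
    by (intro integrable_continuous_real) (auto intro: continuous_on_subset)
  then have int: "(V t has_integral integral {0..s} (V t)) {0..s}"
    by (rule integrable_integral)
  have "s *\<^sub>R integral {0..1} (\<lambda>x. V t (s * x)) = integral {0..s} (V t)"
  proof (cases "s = 0")
    case False
    have "((\<lambda>x. V t (s * x)) has_integral (1 / \<bar>s\<bar>) *\<^sub>R integral {0..s} (V t)) ((\<lambda>x. x / s) ` {0..s})"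
      using has_integral_stretch_real[OF int False] .
    moreover have "(\<lambda>x. x / s) ` {0..s} = {0..1}"
      using ts False by (auto simp: image_iff field_simps intro!: bexI[of _ "s * _"])
    ultimately show ?thesis
      using ts False by (simp add: integral_unique)
  qed simp
  then show "snd z *\<^sub>R integral {0..1} (\<lambda>x. V (fst z) (snd z * x)) = (\<lambda>(t, s). integral {0..s} (V t)) z"
    using ts by simp
qed

section \<open>Regular homotopies preserve the homotopy class and the index\<close>

context covered_surface
begin

lemma regular_homotopy_imp_homotopic_paths:
  assumes C1: "C1_curve M A a\<^sub>1 b\<^sub>1 \<gamma>\<^sub>1" "C1_curve M A a\<^sub>2 b\<^sub>2 \<gamma>\<^sub>2"
    and hom: "regularly_homotopic_fixing_base M A g a\<^sub>1 b\<^sub>1 \<gamma>\<^sub>1 a\<^sub>2 b\<^sub>2 \<gamma>\<^sub>2"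
  shows "homotopic_paths M (unit_path a\<^sub>1 b\<^sub>1 \<gamma>\<^sub>1) (unit_path a\<^sub>2 b\<^sub>2 \<gamma>\<^sub>2)"
proof -
  obtain a b \<sigma> where rh: "regular_homotopy M A g a b \<sigma>"
    and rep: "reparametrization a\<^sub>1 b\<^sub>1 \<gamma>\<^sub>1 a b (\<sigma> 0)" "reparametrization a\<^sub>2 b\<^sub>2 \<gamma>\<^sub>2 a b (\<sigma> 1)"
    and base: "\<And>t. t \<in> {0..1} \<Longrightarrow> \<sigma> t a = \<gamma>\<^sub>1 a\<^sub>1"
    using hom unfolding regularly_homotopic_fixing_base_def by blast
  have closed: "regular_closed_curve M A g a b (\<sigma> t)" if "t \<in> {0..1}" for t
    using rh that by (simp add: regular_homotopy_def)
  have ab: "a < b"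
    using closed[of 0] by (simp add: regular_closed_curve_def regular_curve_def C1_curve_def)
  have \<sigma>_M: "\<sigma> t u \<in> M" if "t \<in> {0..1}" "u \<in> {a..b}" for t u
    using closed[OF that(1)] that(2)
    by (auto simp: regular_closed_curve_def regular_curve_def C1_curve_def)
  have \<sigma>_b: "\<sigma> t b = \<gamma>\<^sub>1 a\<^sub>1" if "t \<in> {0..1}" for t
    using closed[OF that] base[OF that] by (simp add: regular_closed_curve_def)
  have "homotopic_paths M (unit_path a\<^sub>1 b\<^sub>1 \<gamma>\<^sub>1) (unit_path a b (\<sigma> 0))"
    by (rule homotopic_paths_reparametrization) (use C1 rep ab in \<open>auto simp: C1_curve_def\<close>)
  moreover have "homotopic_paths M (unit_path a b (\<sigma> 0)) (unit_path a b (\<sigma> 1))"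
    unfolding homotopic_paths
  proof (intro exI[of _ "\<lambda>(t, s). \<sigma> t (a + s * (b - a))"] conjI ballI)
    have \<sigma>_cont: "continuous_on ({0..1} \<times> {a..b}) (\<lambda>(t, u). \<sigma> t u)"
      using rh by (simp add: regular_homotopy_def)
    have "continuous_on ({0..1} \<times> {0..1}) (\<lambda>z. (\<lambda>(t, u). \<sigma> t u) (fst z, a + snd z * (b - a)))"
    proof (rule continuous_on_compose2[OF \<sigma>_cont])
      show "(\<lambda>z. (fst z, a + snd z * (b - a))) ` ({0..1} \<times> {0..1}) \<subseteq> {0..1::real} \<times> {a..b}"
        using unit_path_affine_in[of a b] ab by auto
    qed (intro continuous_intros)
    then show "continuous_on ({0..1} \<times> {0..1}) (\<lambda>(t, s). \<sigma> t (a + s * (b - a)))"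
      by (simp add: case_prod_beta)
    show "(\<lambda>(t, s). \<sigma> t (a + s * (b - a))) \<in> {0..1} \<times> {0..1} \<rightarrow> M"
      using \<sigma>_M unit_path_affine_in[of a b] ab by auto
  qed (use base \<sigma>_b in \<open>auto simp: unit_path_def pathstart_def pathfinish_def\<close>)
  moreover have "homotopic_paths M (unit_path a b (\<sigma> 1)) (unit_path a\<^sub>2 b\<^sub>2 \<gamma>\<^sub>2)"
    by (rule homotopic_paths_sym[OF homotopic_paths_reparametrization])
       (use C1 rep ab in \<open>auto simp: C1_curve_def\<close>)
  ultimately show ?thesis
    using homotopic_paths_trans by blast
qed

lemma i_index_lift_reparametrization:
  assumes reg: "regular_curve M A a b \<gamma>" and lift: "is_lift W \<pi> a b \<gamma> \<gamma>'" "is_lift W \<pi> c d \<delta> \<kappa>"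
    and rep: "reparametrization a b \<gamma> c d \<delta>" and "c < d" and start: "\<gamma>' a = \<kappa> c"
  shows "i_index c d \<kappa> = i_index a b \<gamma>'"
proof -
  have ab: "a < b"
    using reg by (simp add: regular_curve_def C1_curve_def)
  obtain h h' where h: "h c = a" "h d = b"
    "\<And>u. u \<in> {c..d} \<Longrightarrow> (h has_real_derivative h' u) (at u within {c..d})"
    "\<And>u. u \<in> {c..d} \<Longrightarrow> 0 < h' u" and \<delta>: "\<And>u. u \<in> {c..d} \<Longrightarrow> \<delta> u = \<gamma> (h u)"
    using rep unfolding reparametrization_def by blast
  have into: "h u \<in> {a..b}" if "u \<in> {c..d}" for u
    using reparametrization_map_into[OF h that] .
  have \<gamma>': "continuous_on {a..b} \<gamma>'" "\<And>u. u \<in> {a..b} \<Longrightarrow> \<gamma>' u \<in> W" "\<And>u. u \<in> {a..b} \<Longrightarrow> \<pi> (\<gamma>' u) = \<gamma> u"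
    and \<kappa>: "continuous_on {c..d} \<kappa>" "\<And>u. u \<in> {c..d} \<Longrightarrow> \<kappa> u \<in> W" "\<And>u. u \<in> {c..d} \<Longrightarrow> \<pi> (\<kappa> u) = \<delta> u"
    using lift by (auto simp: is_lift_def)
  have "continuous_on {c..d} h"
    using h(3) by (meson DERIV_continuous continuous_on_eq_continuous_within)
  then have h_lift: "continuous_on {c..d} (\<lambda>u. \<gamma>' (h u))"
    by (rule continuous_on_compose2[OF \<gamma>'(1)]) (use into in auto)
  have "\<kappa> u = \<gamma>' (h u)" if u: "u \<in> {c..d}" for u
  proof (rule covering_space_lift_unique[OF covering, where T = "{c..d}" and a = c
      and f = \<delta> and ?g1.0 = \<kappa> and ?g2.0 = "\<lambda>u. \<gamma>' (h u)"])
    have "continuous_on {c..d} (\<lambda>u. \<pi> (\<kappa> u))"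
      by (rule continuous_on_compose2[OF covering_space_imp_continuous[OF covering] \<kappa>(1)]) (use \<kappa> in auto)
    then show "continuous_on {c..d} \<delta>"
      by (rule continuous_on_eq) (simp add: \<kappa>)
    show "\<delta> \<in> {c..d} \<rightarrow> M"
      using \<kappa>(2) proj_in by (auto simp: \<kappa>(3)[symmetric])
  qed (use \<kappa> h_lift \<gamma>' \<delta> into start h(1) \<open>c < d\<close> u in auto)
  then show ?thesis
    using i_index_reparametrization[OF \<open>c < d\<close> ab h lift_velocity(4,3,1)[OF reg lift(1)]] by blast
qed

text \<open>The velocities of all lifted stages together form one nowhere zero function on a contractible rectangle, which
has a continuous angle there. Its values on the two edges \<open>u = a\<close> and \<open>u = b\<close> are determined
modulo \<open>2\<pi>\<close> by the fixed end directions and are hence constant.\<close>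

lemma regular_homotopy_imp_i_index_eq:
  assumes closed: "regular_closed_curve M A g a\<^sub>1 b\<^sub>1 \<gamma>\<^sub>1" "regular_closed_curve M A g a\<^sub>2 b\<^sub>2 \<gamma>\<^sub>2"
    and lift: "is_lift W \<pi> a\<^sub>1 b\<^sub>1 \<gamma>\<^sub>1 \<gamma>\<^sub>1'" "is_lift W \<pi> a\<^sub>2 b\<^sub>2 \<gamma>\<^sub>2 \<gamma>\<^sub>2'" "\<gamma>\<^sub>1' a\<^sub>1 = \<gamma>\<^sub>2' a\<^sub>2"
    and hom: "regularly_homotopic_fixing_base M A g a\<^sub>1 b\<^sub>1 \<gamma>\<^sub>1 a\<^sub>2 b\<^sub>2 \<gamma>\<^sub>2"
  shows "i_index a\<^sub>1 b\<^sub>1 \<gamma>\<^sub>1' = i_index a\<^sub>2 b\<^sub>2 \<gamma>\<^sub>2'"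
proof -
  obtain a b \<sigma> where rh: "regular_homotopy M A g a b \<sigma>"
    and rep: "reparametrization a\<^sub>1 b\<^sub>1 \<gamma>\<^sub>1 a b (\<sigma> 0)" "reparametrization a\<^sub>2 b\<^sub>2 \<gamma>\<^sub>2 a b (\<sigma> 1)"
    and base: "\<And>t. t \<in> {0..1} \<Longrightarrow> \<sigma> t a = \<gamma>\<^sub>1 a\<^sub>1"
      "\<And>t. t \<in> {0..1} \<Longrightarrow> direction A g a b (\<sigma> t) a = direction A g a\<^sub>1 b\<^sub>1 \<gamma>\<^sub>1 a\<^sub>1"
    using hom unfolding regularly_homotopic_fixing_base_def by blast
  have \<sigma>: "regular_curve M A a b (\<sigma> t)" "\<sigma> t b = \<gamma>\<^sub>1 a\<^sub>1"
      "direction A g a b (\<sigma> t) b = direction A g a\<^sub>1 b\<^sub>1 \<gamma>\<^sub>1 a\<^sub>1" if "t \<in> {0..1}" for t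
    using rh base[OF that] that by (simp_all add: regular_homotopy_def regular_closed_curve_def)
  have ab: "a < b"
    using \<sigma>(1)[of 0] by (simp add: regular_curve_def C1_curve_def)
  have \<sigma>_M: "\<sigma> t u \<in> M" if "t \<in> {0..1}" "u \<in> {a..b}" for t u
    using \<sigma>(1)[OF that(1)] that(2) by (auto simp: regular_curve_def C1_curve_def)
  have reg: "regular_curve M A a\<^sub>1 b\<^sub>1 \<gamma>\<^sub>1" "regular_curve M A a\<^sub>2 b\<^sub>2 \<gamma>\<^sub>2"
    using closed by (simp_all add: regular_closed_curve_def)
  have "a\<^sub>1 \<in> {a\<^sub>1..b\<^sub>1}"
    using reg by (simp add: regular_curve_def C1_curve_def)
  then have start: "\<gamma>\<^sub>1' a\<^sub>1 \<in> W" "\<gamma>\<^sub>1 a\<^sub>1 = \<pi> (\<gamma>\<^sub>1' a\<^sub>1)"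
    using lift(1) by (auto simp: is_lift_def)
  let ?Q = "{0..1::real} \<times> {a..b}"
  obtain k where k: "continuous_on ?Q (\<lambda>(t, u). k t u)"
    "\<And>t u. t \<in> {0..1} \<Longrightarrow> u \<in> {a..b} \<Longrightarrow> k t u \<in> W"
    "\<And>t u. t \<in> {0..1} \<Longrightarrow> u \<in> {a..b} \<Longrightarrow> \<pi> (k t u) = \<sigma> t u"
    "\<And>t. t \<in> {0..1} \<Longrightarrow> k t a = \<gamma>\<^sub>1' a\<^sub>1" "\<And>t. t \<in> {0..1} \<Longrightarrow> k t b = k 0 b"
    using covering_space_lift_square[OF covering, of a b \<sigma> "\<gamma>\<^sub>1' a\<^sub>1" "\<gamma>\<^sub>1 a\<^sub>1"]
      ab rh \<sigma>_M base(1) start \<sigma>(2) unfolding regular_homotopy_def by auto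
  have k_lift: "is_lift W \<pi> a b (\<sigma> t) (k t)" if t: "t \<in> {0..1}" for t
    using continuous_on_slice[OF k(1) t] k(2,3) t by (auto simp: is_lift_def)
  define X where "X z = vector_derivative (k (fst z)) (at (snd z) within {a..b})" for z :: "real \<times> real"
  note vel = lift_velocity[OF \<sigma>(1) k_lift]
  have X_cont: "continuous_on ?Q X"
  proof (rule continuous_on_proj_diff_cancel[OF k(1)])
    show "(\<lambda>(t, u). k t u) ` ?Q \<subseteq> W"
      using k(2) by auto
    fix c assume c: "c \<in> A"
    show "continuous_on {z \<in> ?Q. \<pi> (case z of (t, u) \<Rightarrow> k t u) \<in> fst c}
        (\<lambda>z. proj_diff c (case z of (t, u) \<Rightarrow> k t u) (X z))"
    proof (rule continuous_on_eq)
      have "{z \<in> ?Q. \<pi> (case z of (t, u) \<Rightarrow> k t u) \<in> fst c}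
          = {(t, u). t \<in> {0..1} \<and> u \<in> {a..b} \<and> \<sigma> t u \<in> fst c}"
        using k(3) by auto
      then show "continuous_on {z \<in> ?Q. \<pi> (case z of (t, u) \<Rightarrow> k t u) \<in> fst c}
          (\<lambda>(t, u). velocity A a b (\<sigma> t) u c)"
        using rh c unfolding regular_homotopy_def by (simp only:)
      show "(case z of (t, u) \<Rightarrow> velocity A a b (\<sigma> t) u c) = proj_diff c (case z of (t, u) \<Rightarrow> k t u) (X z)"
        if z: "z \<in> {z \<in> ?Q. \<pi> (case z of (t, u) \<Rightarrow> k t u) \<in> fst c}" for z
      proof -
        obtain t u where tu: "z = (t, u)" "t \<in> {0..1}" "u \<in> {a..b}" "\<sigma> t u \<in> fst c"
          using z k(3) by auto
        then have "c \<in> charts_at A (\<sigma> t u)"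
          using c by (simp add: charts_at_def)
        then show ?thesis
          using vel(2)[OF tu(2,2,3)] tu(1) by (simp add: X_def)
      qed
    qed
  qed
  have X_nz: "X z \<noteq> 0" if "z \<in> ?Q" for z
    using vel(3) that by (auto simp: X_def)
  have "contractible ?Q"
    by (intro convex_imp_contractible convex_Times convex_closed_interval)
  then obtain \<theta> where \<theta>: "continuous_on ?Q \<theta>" "\<And>z. z \<in> ?Q \<Longrightarrow> X z = norm (X z) *\<^sub>R cis (\<theta> z)"
    using continuous_polar_form[OF X_cont _ X_nz] by blast
  have slice: "continuous_on {a..b} (\<lambda>u. \<theta> (t, u))" if "t \<in> {0..1}" for t
    by (rule continuous_on_compose2[OF \<theta>(1)]) (use that in \<open>auto intro!: continuous_intros\<close>)
  have index: "i_index a b (k t) = (\<theta> (t, b) - \<theta> (t, a)) / (2 * pi)" if t: "t \<in> {0..1}" for t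
  proof (rule i_index_eq)
    show "angle_function a b (k t) (\<lambda>u. \<theta> (t, u))"
    proof (rule angle_functionI[OF ab slice[OF t], where v = "\<lambda>u. X (t, u)"])
      fix u assume u: "u \<in> {a..b}"
      show "(k t has_vector_derivative X (t, u)) (at u within {a..b})"
        using vel(1)[OF t t u] by (simp add: X_def)
    qed (use X_nz \<theta>(2) t in auto)
  qed (use ab in simp)
  \<comment> \<open>the end directions of the lifts are fixed during the homotopy, hence so are their angles\<close>
  have ends: "\<theta> (1, e) = \<theta> (0, e)" if e: "e = a \<or> e = b" for e
  proof (rule cis_eq_imp_const[of "{0..1}" "\<lambda>t. \<theta> (t, e)" "cis (\<theta> (0, e))"])
    have e_in: "e \<in> {a..b}"
      using e ab by auto
    show "continuous_on {0..1} (\<lambda>t. \<theta> (t, e))"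
      by (rule continuous_on_compose2[OF \<theta>(1)]) (use e_in in \<open>auto intro!: continuous_intros\<close>)
    fix t :: real assume t: "t \<in> {0..1}"
    have z: "(0::real) \<in> {0..1}"
      by simp
    have "direction A g a b (\<sigma> t) e = direction A g a b (\<sigma> 0) e"
      using e base(2) \<sigma>(3) t z by metis
    moreover have "k t e = k 0 e"
      using e k(4,5) t z by metis
    ultimately obtain l where l: "0 < l" "X (t, e) = l *\<^sub>R X (0, e)"
      using direction_eq_iff_lift[OF \<sigma>(1)[OF t] \<sigma>(1)[OF z] k_lift[OF t] k_lift[OF z] e_in e_in]
      by (auto simp: X_def)
    have "X (s, e) /\<^sub>R norm (X (s, e)) = cis (\<theta> (s, e))" if "s \<in> {0..1}" for s
      by (rule polar_cis[OF _ \<theta>(2)]) (use X_nz[of "(s, e)"] that e_in in auto)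
    from this[OF t] this[OF z] show "cis (\<theta> (t, e)) = cis (\<theta> (0, e))"
      using direction_scaleR[OF l(1), of "X (0, e)"] unfolding l(2) by simp
  qed auto
  have "i_index a\<^sub>1 b\<^sub>1 \<gamma>\<^sub>1' = i_index a b (k 0)"
    using i_index_lift_reparametrization[OF reg(1) lift(1) k_lift rep(1) ab] k(4)[of 0] by simp
  also have "\<dots> = i_index a b (k 1)"
    using index ends by simp
  also have "\<dots> = i_index a\<^sub>2 b\<^sub>2 \<gamma>\<^sub>2'"
    using i_index_lift_reparametrization[OF reg(2) lift(2) k_lift rep(2) ab] k(4)[of 1] lift(3) by simp
  finally show ?thesis .
qed

end

section \<open>Constructing regular homotopies\<close>

text \<open>Arcs are recovered from their velocities by integration, so the end points are kept if and only if the
integral of the velocity is kept. The common start direction allows to shift the second angle function by a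
multiple of \<open>2\<pi>\<close> so that both agree at \<open>0\<close>; by equality of the indices they then also agree at
\<open>1\<close>, so every interpolated angle starts and ends with the same values.\<close>

lemma whitney_graustein_fixed_ends:
  assumes deriv: "\<And>u. u \<in> {0..1} \<Longrightarrow> (c\<^sub>1 has_vector_derivative v\<^sub>1 u) (at u within {0..1})"
      "\<And>u. u \<in> {0..1} \<Longrightarrow> (c\<^sub>2 has_vector_derivative v\<^sub>2 u) (at u within {0..1})"
    and cont: "continuous_on {0..1} v\<^sub>1" "continuous_on {0..1} v\<^sub>2"
    and nz: "\<And>u. u \<in> {0..1} \<Longrightarrow> v\<^sub>1 u \<noteq> 0" "\<And>u. u \<in> {0..1} \<Longrightarrow> v\<^sub>2 u \<noteq> 0"
    and ends: "c\<^sub>1 0 = c\<^sub>2 0" "c\<^sub>1 1 = c\<^sub>2 1"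
    and start_dir: "\<exists>l>0. v\<^sub>1 0 = l *\<^sub>R v\<^sub>2 0"
    and index: "i_index 0 1 c\<^sub>1 = i_index 0 1 c\<^sub>2"
  obtains S V :: "real \<Rightarrow> real \<Rightarrow> complex" where
    "continuous_on ({0..1} \<times> {0..1}) (\<lambda>(t, u). S t u)"
    "continuous_on ({0..1} \<times> {0..1}) (\<lambda>(t, u). V t u)"
    "\<And>t u. t \<in> {0..1} \<Longrightarrow> u \<in> {0..1} \<Longrightarrow> V t u \<noteq> 0"
    "\<And>t u. t \<in> {0..1} \<Longrightarrow> u \<in> {0..1} \<Longrightarrow> (S t has_vector_derivative V t u) (at u within {0..1})"
    "\<And>u. u \<in> {0..1} \<Longrightarrow> S 0 u = c\<^sub>1 u" "\<And>u. u \<in> {0..1} \<Longrightarrow> S 1 u = c\<^sub>2 u"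
    "\<And>t. t \<in> {0..1} \<Longrightarrow> S t 0 = c\<^sub>1 0" "\<And>t. t \<in> {0..1} \<Longrightarrow> S t 1 = c\<^sub>1 1"
    "\<And>t. t \<in> {0..1} \<Longrightarrow> \<exists>l>0. V t 0 = l *\<^sub>R v\<^sub>1 0"
    "\<And>t. t \<in> {0..1} \<Longrightarrow> \<exists>l>0. V t 1 = l *\<^sub>R v\<^sub>1 1"
proof -
  have I: "contractible {0..1::real}"
    by (intro convex_imp_contractible convex_closed_interval)
  obtain \<theta>\<^sub>1 where \<theta>1: "continuous_on {0..1} \<theta>\<^sub>1" "\<And>u. u \<in> {0..1} \<Longrightarrow> v\<^sub>1 u = norm (v\<^sub>1 u) *\<^sub>R cis (\<theta>\<^sub>1 u)"
    using continuous_polar_form[OF cont(1) I nz(1)] by blast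
  obtain \<alpha> where \<alpha>: "continuous_on {0..1} \<alpha>" "\<And>u. u \<in> {0..1} \<Longrightarrow> v\<^sub>2 u = norm (v\<^sub>2 u) *\<^sub>R cis (\<alpha> u)"
    using continuous_polar_form[OF cont(2) I nz(2)] by blast
  have in01: "(0::real) \<in> {0..1}" "(1::real) \<in> {0..1}"
    by auto
  have "cis (\<theta>\<^sub>1 0) = cis (\<alpha> 0)"
  proof -
    obtain l where l: "0 < l" "v\<^sub>1 0 = l *\<^sub>R v\<^sub>2 0"
      using start_dir by blast
    have "v\<^sub>1 0 /\<^sub>R norm (v\<^sub>1 0) = cis (\<theta>\<^sub>1 0)"
      by (rule polar_cis[OF _ \<theta>1(2)]) (use nz(1)[OF in01(1)] in auto)
    moreover have "v\<^sub>2 0 /\<^sub>R norm (v\<^sub>2 0) = cis (\<alpha> 0)"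
      by (rule polar_cis[OF _ \<alpha>(2)]) (use nz(2)[OF in01(1)] in auto)
    ultimately show ?thesis
      using direction_scaleR[OF l(1), of "v\<^sub>2 0"] unfolding l(2) by simp
  qed
  then obtain n :: int where n: "\<theta>\<^sub>1 0 = \<alpha> 0 + 2 * pi * n"
    using sin_cos_eq_iff[of "\<theta>\<^sub>1 0" "\<alpha> 0"] by (auto simp: complex_eq_iff)
  define \<theta>\<^sub>2 where "\<theta>\<^sub>2 u = \<alpha> u + 2 * pi * n" for u
  have "cis (\<theta>\<^sub>2 u) = cis (\<alpha> u)" for u
    using sin_cos_eq_iff[of "\<theta>\<^sub>2 u" "\<alpha> u"] by (auto simp: \<theta>\<^sub>2_def complex_eq_iff)
  then have \<theta>2: "continuous_on {0..1} \<theta>\<^sub>2" "\<And>u. u \<in> {0..1} \<Longrightarrow> v\<^sub>2 u = norm (v\<^sub>2 u) *\<^sub>R cis (\<theta>\<^sub>2 u)"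
    using \<alpha> unfolding \<theta>\<^sub>2_def by (auto intro!: continuous_intros)
  have \<theta>_start: "\<theta>\<^sub>1 0 = \<theta>\<^sub>2 0"
    by (simp add: \<theta>\<^sub>2_def n)
  have "(\<theta>\<^sub>1 1 - \<theta>\<^sub>1 0) / (2 * pi) = (\<theta>\<^sub>2 1 - \<theta>\<^sub>2 0) / (2 * pi)"
    using i_index_eq[OF zero_le_one angle_functionI[OF zero_less_one \<theta>1(1) deriv(1) nz(1) \<theta>1(2)]]
      i_index_eq[OF zero_le_one angle_functionI[OF zero_less_one \<theta>2(1) deriv(2) nz(2) \<theta>2(2)]] index
    by simp
  then have \<theta>_end: "\<theta>\<^sub>1 1 = \<theta>\<^sub>2 1"
    using \<theta>_start by simp
  define d where "d = c\<^sub>1 1 - c\<^sub>1 0"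
  have int: "(v\<^sub>1 has_integral d) {0..1}" "(v\<^sub>2 has_integral d) {0..1}"
    using fundamental_theorem_of_calculus[OF zero_le_one deriv(1)]
      fundamental_theorem_of_calculus[OF zero_le_one deriv(2)] ends by (simp_all add: d_def)
  have int_polar: "((\<lambda>u. norm (v\<^sub>1 u) *\<^sub>R cis (\<theta>\<^sub>1 u)) has_integral d) {0..1}"
    "((\<lambda>u. norm (v\<^sub>2 u) *\<^sub>R cis (\<theta>\<^sub>2 u)) has_integral d) {0..1}"
    using has_integral_eq[OF \<theta>1(2) int(1)] has_integral_eq[OF \<theta>2(2) int(2)] by simp_all
  have norm_cont: "continuous_on {0..1} (\<lambda>u. norm (v\<^sub>1 u))" "continuous_on {0..1} (\<lambda>u. norm (v\<^sub>2 u))"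
    using cont by (auto intro: continuous_intros)
  have norm_pos: "0 < norm (v\<^sub>1 u)" "0 < norm (v\<^sub>2 u)" if "u \<in> {0..1}" for u
    using nz that by simp_all
  obtain V :: "real \<Rightarrow> real \<Rightarrow> complex" where V: "continuous_on ({0..1} \<times> {0..1}) (\<lambda>(t, u). V t u)"
    "\<And>t u. t \<in> {0..1} \<Longrightarrow> u \<in> {0..1} \<Longrightarrow> V t u \<noteq> 0"
    "\<And>u. V 0 u = norm (v\<^sub>1 u) *\<^sub>R cis (\<theta>\<^sub>1 u)" "\<And>u. V 1 u = norm (v\<^sub>2 u) *\<^sub>R cis (\<theta>\<^sub>2 u)"
    "\<And>t. t \<in> {0..1} \<Longrightarrow> (V t has_integral d) {0..1}"
    "\<And>t. t \<in> {0..1} \<Longrightarrow> \<exists>c>0. V t 0 = c *\<^sub>R cis (\<theta>\<^sub>1 0)"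
    "\<And>t. t \<in> {0..1} \<Longrightarrow> \<exists>c>0. V t 1 = c *\<^sub>R cis (\<theta>\<^sub>1 1)"
    by (rule velocity_interpolation[OF norm_cont \<theta>1(1) \<theta>2(1) norm_pos \<theta>_start \<theta>_end int_polar])
       (assumption+, rule that)
  define S where "S t u = c\<^sub>1 0 + integral {0..u} (V t)" for t u
  have endpoint: "S t u = c u"
    if u: "u \<in> {0..1}" and V_eq: "\<And>x. x \<in> {0..1} \<Longrightarrow> V t x = v x" and "c 0 = c\<^sub>1 0"
      and c: "\<And>x. x \<in> {0..1} \<Longrightarrow> (c has_vector_derivative v x) (at x within {0..1})" for t u c v
  proof -
    have "(v has_integral c u - c 0) {0..u}"
    proof (rule fundamental_theorem_of_calculus)
      show "(c has_vector_derivative v x) (at x within {0..u})" if "x \<in> {0..u}" for x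
        by (rule has_vector_derivative_within_subset[OF c]) (use that u in auto)
    qed (use u in simp)
    then have "(V t has_integral c u - c 0) {0..u}"
      by (rule has_integral_eq[rotated]) (use V_eq u in auto)
    then show ?thesis
      using \<open>c 0 = c\<^sub>1 0\<close> by (simp add: S_def integral_unique)
  qed
  have parallel: "\<exists>l>0. c *\<^sub>R cis (\<theta>\<^sub>1 e) = l *\<^sub>R v\<^sub>1 e" if "0 < c" "e \<in> {0..1}" for c e
  proof -
    have "c *\<^sub>R cis (\<theta>\<^sub>1 e) = (c / norm (v\<^sub>1 e)) *\<^sub>R (norm (v\<^sub>1 e) *\<^sub>R cis (\<theta>\<^sub>1 e))"
      using nz(1)[OF that(2)] by simp
    then show ?thesis
      using \<theta>1(2)[OF that(2)] nz(1)[OF that(2)] that(1)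
      by (intro exI[of _ "c / norm (v\<^sub>1 e)"]) auto
  qed
  show thesis
  proof (rule that[of S V])
    have "continuous_on ({0..1} \<times> {0..1}) (\<lambda>z. c\<^sub>1 0 + (\<lambda>(t, u). integral {0..u} (V t)) z)"
      by (intro continuous_intros continuous_on_indefinite_integral V)
    then show "continuous_on ({0..1} \<times> {0..1}) (\<lambda>(t, u). S t u)"
      by (simp add: S_def case_prod_beta)
    show "S 0 u = c\<^sub>1 u" if "u \<in> {0..1}" for u
      by (rule endpoint[OF that _ _ deriv(1)]) (use V(3) \<theta>1(2) in auto)
    show "S 1 u = c\<^sub>2 u" if "u \<in> {0..1}" for u
      by (rule endpoint[OF that _ _ deriv(2)]) (use V(4) \<theta>2(2) ends in auto)
  next
    fix t :: real assume t: "t \<in> {0..1}"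
    show "S t 0 = c\<^sub>1 0"
      by (simp add: S_def)
    show "S t 1 = c\<^sub>1 1"
      using integral_unique[OF V(5)[OF t]] by (simp add: S_def d_def)
    show "\<exists>l>0. V t 0 = l *\<^sub>R v\<^sub>1 0" "\<exists>l>0. V t 1 = l *\<^sub>R v\<^sub>1 1"
      using V(6,7)[OF t] parallel in01 by metis+
    fix u :: real assume u: "u \<in> {0..1}"
    have "((\<lambda>u. integral {0..u} (V t)) has_vector_derivative V t u) (at u within {0..1})"
      by (intro integral_has_vector_derivative u continuous_on_slice[OF V(1) t])
    then have "((\<lambda>u. c\<^sub>1 0 + integral {0..u} (V t)) has_vector_derivative 0 + V t u) (at u within {0..1})"
      by (intro has_vector_derivative_add has_vector_derivative_const)
    then show "(S t has_vector_derivative V t u) (at u within {0..1})"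
      by (simp add: S_def[abs_def])
  qed (use V in auto)
qed

lemma frechet_derivative_eq_id:
  fixes f :: "'a::real_normed_vector \<Rightarrow> 'a"
  assumes "open U" "x \<in> U" "\<And>y. y \<in> U \<Longrightarrow> f y = y"
  shows "frechet_derivative f (at x) v = v"
proof -
  have "((\<lambda>y. y) has_derivative (\<lambda>v. v)) (at x)"
    by (rule has_derivative_ident)
  then have "(f has_derivative (\<lambda>v. v)) (at x)"
    by (rule has_derivative_transform_within_open[OF _ assms(1,2)]) (simp add: assms(3))
  then show ?thesis
    by (metis frechet_derivative_at)
qed

context covered_surface
begin

text \<open>Tameness is applied to a compact neighbourhood of \<open>C\<close>: being the identity on \<open>C\<close> alone would not determine
the differential on \<open>C\<close>, which is needed to keep directions.\<close>

lemma tame_imp_regular_map_fixing_neighbourhood: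
  assumes "tame M A g W \<pi>" and C: "compact C" "C \<subseteq> W"
  obtains f U where "smooth_on f UNIV" "\<And>x. f x \<in> W" "\<And>x. bij (frechet_derivative f (at x))"
    "open U" "C \<subseteq> U" "\<And>x. x \<in> U \<Longrightarrow> f x = x"
proof -
  have W: "open W"
    using assms(1) by (simp add: tame_def conformally_euclidean_structure_def)
  obtain \<epsilon> where \<epsilon>: "0 < \<epsilon>" "(\<Union>x\<in>C. cball x \<epsilon>) \<subseteq> W"
    using compact_subset_open_imp_cball_epsilon_subset[OF C(1) W C(2)] by blast
  define K where "K = {x + y |x y. x \<in> C \<and> y \<in> cball 0 \<epsilon>}"
  have K_eq: "K = (\<Union>x\<in>C. cball x \<epsilon>)"
  proof (intro set_eqI iffI)
    fix z assume "z \<in> K"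
    then obtain x y where "z = x + y" "x \<in> C" "norm y \<le> \<epsilon>"
      by (auto simp: K_def)
    then show "z \<in> (\<Union>x\<in>C. cball x \<epsilon>)"
      by (auto simp: dist_norm intro!: bexI[of _ x])
  next
    fix z assume "z \<in> (\<Union>x\<in>C. cball x \<epsilon>)"
    then obtain x where "x \<in> C" "norm (z - x) \<le> \<epsilon>"
      by (auto simp: dist_norm norm_minus_commute)
    then show "z \<in> K"
      unfolding K_def mem_Collect_eq by (intro exI[of _ x] exI[of _ "z - x"]) simp
  qed
  have "compact K"
    unfolding K_def by (rule compact_sums[OF C(1) compact_cball])
  moreover have "K \<subseteq> interior W"
    using \<epsilon>(2) W K_eq by (simp add: interior_open)
  moreover have "\<forall>K. compact K \<and> K \<subseteq> interior W \<longrightarrow>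
      (\<exists>f. smooth_on f UNIV \<and> f ` UNIV \<subseteq> W \<and> (\<forall>x. bij (frechet_derivative f (at x))) \<and> (\<forall>x\<in>K. f x = x))"
    using assms(1) unfolding tame_def by (elim conjE)
  ultimately obtain f where f: "smooth_on f UNIV" "f ` UNIV \<subseteq> W"
    "\<And>x. bij (frechet_derivative f (at x))" "\<And>x. x \<in> K \<Longrightarrow> f x = x"
    by metis
  show thesis
  proof (rule that[OF f(1) _ f(3)])
    show "open (\<Union>x\<in>C. ball x \<epsilon>)" "C \<subseteq> (\<Union>x\<in>C. ball x \<epsilon>)"
      using \<epsilon>(1) by auto
    show "f x = x" if "x \<in> (\<Union>x\<in>C. ball x \<epsilon>)" for x
      by (rule f(4)) (use that K_eq in \<open>auto intro: less_imp_le\<close>)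
  qed (use f(2) in auto)
qed

text \<open>The lifts, reparametrized to the unit interval, satisfy the assumptions of the Whitney-Graustein lemma. Its
homotopy \<open>S\<close> is pushed into \<open>W\<close> by a regular map \<open>f\<close> that is the identity near both lifts, so the first and
the last stage and the velocities at the ends are not affected, and then projected to \<open>M\<close>.\<close>

lemma regular_homotopy_if_index_eq:
  assumes tame: "tame M A g W \<pi>"
    and closed: "regular_closed_curve M A g a\<^sub>1 b\<^sub>1 \<gamma>\<^sub>1" "regular_closed_curve M A g a\<^sub>2 b\<^sub>2 \<gamma>\<^sub>2"
    and dir: "direction A g a\<^sub>1 b\<^sub>1 \<gamma>\<^sub>1 a\<^sub>1 = direction A g a\<^sub>2 b\<^sub>2 \<gamma>\<^sub>2 a\<^sub>2"
    and lift: "is_lift W \<pi> a\<^sub>1 b\<^sub>1 \<gamma>\<^sub>1 \<gamma>\<^sub>1'" "is_lift W \<pi> a\<^sub>2 b\<^sub>2 \<gamma>\<^sub>2 \<gamma>\<^sub>2'" "\<gamma>\<^sub>1' a\<^sub>1 = \<gamma>\<^sub>2' a\<^sub>2"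
    and hom: "homotopic_paths M (unit_path a\<^sub>1 b\<^sub>1 \<gamma>\<^sub>1) (unit_path a\<^sub>2 b\<^sub>2 \<gamma>\<^sub>2)"
    and index: "i_index a\<^sub>1 b\<^sub>1 \<gamma>\<^sub>1' = i_index a\<^sub>2 b\<^sub>2 \<gamma>\<^sub>2'"
  shows "regularly_homotopic_fixing_base M A g a\<^sub>1 b\<^sub>1 \<gamma>\<^sub>1 a\<^sub>2 b\<^sub>2 \<gamma>\<^sub>2"
proof -
  have reg: "regular_curve M A a\<^sub>1 b\<^sub>1 \<gamma>\<^sub>1" "regular_curve M A a\<^sub>2 b\<^sub>2 \<gamma>\<^sub>2"
    using closed by (simp_all add: regular_closed_curve_def)
  have lt: "a\<^sub>1 < b\<^sub>1" "a\<^sub>2 < b\<^sub>2"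
    using reg by (simp_all add: regular_curve_def C1_curve_def)
  define X\<^sub>1 where "X\<^sub>1 u = vector_derivative \<gamma>\<^sub>1' (at u within {a\<^sub>1..b\<^sub>1})" for u
  define X\<^sub>2 where "X\<^sub>2 u = vector_derivative \<gamma>\<^sub>2' (at u within {a\<^sub>2..b\<^sub>2})" for u
  note vel1 = lift_velocity[OF reg(1) lift(1), folded X\<^sub>1_def]
  note vel2 = lift_velocity[OF reg(2) lift(2), folded X\<^sub>2_def]
  define c\<^sub>1 where "c\<^sub>1 = unit_path a\<^sub>1 b\<^sub>1 \<gamma>\<^sub>1'"
  define c\<^sub>2 where "c\<^sub>2 = unit_path a\<^sub>2 b\<^sub>2 \<gamma>\<^sub>2'"
  define v\<^sub>1 where "v\<^sub>1 s = (b\<^sub>1 - a\<^sub>1) *\<^sub>R X\<^sub>1 (a\<^sub>1 + s * (b\<^sub>1 - a\<^sub>1))" for s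
  define v\<^sub>2 where "v\<^sub>2 s = (b\<^sub>2 - a\<^sub>2) *\<^sub>R X\<^sub>2 (a\<^sub>2 + s * (b\<^sub>2 - a\<^sub>2))" for s
  have affine: "((\<lambda>s. a + s * (b - a)) has_real_derivative b - a) (at u within {0..1})" for a b u :: real
    by (auto intro!: derivative_eq_intros)
  have unit: "continuous_on {0..1} (\<lambda>s. (b - a) *\<^sub>R X (a + s * (b - a)))"
      "\<And>u. u \<in> {0..1} \<Longrightarrow> (b - a) *\<^sub>R X (a + u * (b - a)) \<noteq> 0"
      "\<And>u. u \<in> {0..1} \<Longrightarrow>
        (unit_path a b \<kappa> has_vector_derivative (b - a) *\<^sub>R X (a + u * (b - a))) (at u within {0..1})"
      "i_index 0 1 (unit_path a b \<kappa>) = i_index a b \<kappa>"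
      "is_lift W \<pi> 0 1 (unit_path a b \<gamma>) (unit_path a b \<kappa>)"
    if ab: "a < b" and X: "\<And>u. u \<in> {a..b} \<Longrightarrow> (\<kappa> has_vector_derivative X u) (at u within {a..b})"
      "\<And>u. u \<in> {a..b} \<Longrightarrow> X u \<noteq> 0" "continuous_on {a..b} X" and \<kappa>: "is_lift W \<pi> a b \<gamma> \<kappa>"
    for a b :: real and X \<kappa> \<gamma>
  proof -
    have into: "a + s * (b - a) \<in> {a..b}" if "s \<in> {0..1}" for s
      using unit_path_affine_in[of a b s] ab that by simp
    show "continuous_on {0..1} (\<lambda>s. (b - a) *\<^sub>R X (a + s * (b - a)))"
      by (intro continuous_intros continuous_on_compose2[OF X(3)]) (use into in auto)
    show "(b - a) *\<^sub>R X (a + u * (b - a)) \<noteq> 0" if "u \<in> {0..1}" for u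
      using X(2)[OF into[OF that]] ab by simp
    show "(unit_path a b \<kappa> has_vector_derivative (b - a) *\<^sub>R X (a + u * (b - a))) (at u within {0..1})"
      if "u \<in> {0..1}" for u
      by (rule has_vector_derivative_reparametrization[OF affine _ that X(1)[OF into[OF that]]])
         (use into in \<open>auto simp: unit_path_def\<close>)
    show "i_index 0 1 (unit_path a b \<kappa>) = i_index a b \<kappa>"
      by (rule i_index_reparametrization[OF zero_less_one ab _ _ affine _ X(3,2,1)])
         (use ab in \<open>auto simp: unit_path_def\<close>)
    have "continuous_on {0..1} (\<lambda>s. \<kappa> (a + s * (b - a)))"
      by (rule continuous_on_compose2[of "{a..b}" \<kappa>])
         (use into \<kappa> in \<open>auto simp: is_lift_def intro!: continuous_intros\<close>)
    then show "is_lift W \<pi> 0 1 (unit_path a b \<gamma>) (unit_path a b \<kappa>)"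
      using into \<kappa> unfolding is_lift_def unit_path_def by (auto simp: image_subset_iff)
  qed
  note unit1 = unit[OF lt(1) vel1(1,3,4) lift(1), folded c\<^sub>1_def v\<^sub>1_def]
  note unit2 = unit[OF lt(2) vel2(1,3,4) lift(2), folded c\<^sub>2_def v\<^sub>2_def]
  have c_ends: "c\<^sub>1 0 = \<gamma>\<^sub>1' a\<^sub>1" "c\<^sub>1 1 = \<gamma>\<^sub>1' b\<^sub>1" "c\<^sub>2 0 = \<gamma>\<^sub>2' a\<^sub>2"
    by (simp_all add: c\<^sub>1_def c\<^sub>2_def unit_path_def)
  have v_ends: "v\<^sub>1 0 = (b\<^sub>1 - a\<^sub>1) *\<^sub>R X\<^sub>1 a\<^sub>1" "v\<^sub>1 1 = (b\<^sub>1 - a\<^sub>1) *\<^sub>R X\<^sub>1 b\<^sub>1" "v\<^sub>2 0 = (b\<^sub>2 - a\<^sub>2) *\<^sub>R X\<^sub>2 a\<^sub>2"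
    by (simp_all add: v\<^sub>1_def v\<^sub>2_def)
  have c_start: "c\<^sub>1 0 = c\<^sub>2 0"
    using lift(3) c_ends by simp
  have c_end: "c\<^sub>1 1 = c\<^sub>2 1"
    by (rule covering_space_homotopic_lift_ends[OF covering hom unit1(5) unit2(5) c_start])
  have start_dir: "\<exists>l>0. v\<^sub>1 0 = l *\<^sub>R v\<^sub>2 0"
  proof -
    have "a\<^sub>1 \<in> {a\<^sub>1..b\<^sub>1}" "a\<^sub>2 \<in> {a\<^sub>2..b\<^sub>2}"
      using lt by auto
    then obtain l where l: "0 < l" "X\<^sub>1 a\<^sub>1 = l *\<^sub>R X\<^sub>2 a\<^sub>2"
      using direction_eq_iff_lift[OF reg lift(1,2), of a\<^sub>1 a\<^sub>2] dir lift(3)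
      by (auto simp: X\<^sub>1_def X\<^sub>2_def)
    have "v\<^sub>1 0 = ((b\<^sub>1 - a\<^sub>1) * l / (b\<^sub>2 - a\<^sub>2)) *\<^sub>R v\<^sub>2 0"
      using lt by (simp add: v_ends l(2))
    then show ?thesis
      using lt l(1) by (intro exI[of _ "(b\<^sub>1 - a\<^sub>1) * l / (b\<^sub>2 - a\<^sub>2)"]) auto
  qed
  have index': "i_index 0 1 c\<^sub>1 = i_index 0 1 c\<^sub>2"
    using unit1(4) unit2(4) index by simp
  obtain S V :: "real \<Rightarrow> real \<Rightarrow> complex" where S: "continuous_on ({0..1} \<times> {0..1}) (\<lambda>(t, u). S t u)"
    and V: "continuous_on ({0..1} \<times> {0..1}) (\<lambda>(t, u). V t u)"
      "\<And>t u. t \<in> {0..1} \<Longrightarrow> u \<in> {0..1} \<Longrightarrow> V t u \<noteq> 0"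
      "\<And>t u. t \<in> {0..1} \<Longrightarrow> u \<in> {0..1} \<Longrightarrow> (S t has_vector_derivative V t u) (at u within {0..1})"
    and S01: "\<And>u. u \<in> {0..1} \<Longrightarrow> S 0 u = c\<^sub>1 u" "\<And>u. u \<in> {0..1} \<Longrightarrow> S 1 u = c\<^sub>2 u"
    and S_ends: "\<And>t. t \<in> {0..1} \<Longrightarrow> S t 0 = c\<^sub>1 0" "\<And>t. t \<in> {0..1} \<Longrightarrow> S t 1 = c\<^sub>1 1"
    and V_ends: "\<And>t. t \<in> {0..1} \<Longrightarrow> \<exists>l>0. V t 0 = l *\<^sub>R v\<^sub>1 0"
      "\<And>t. t \<in> {0..1} \<Longrightarrow> \<exists>l>0. V t 1 = l *\<^sub>R v\<^sub>1 1"
    by (rule whitney_graustein_fixed_ends[OF unit1(3) unit2(3) unit1(1) unit2(1) unit1(2) unit2(2)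
          c_start c_end start_dir index']) (assumption+, rule that)
  have c_cont: "continuous_on {0..1} c\<^sub>1" "continuous_on {0..1} c\<^sub>2"
    and c_W: "c\<^sub>1 ` {0..1} \<subseteq> W" "c\<^sub>2 ` {0..1} \<subseteq> W"
    and \<pi>_c: "\<And>u. u \<in> {0..1} \<Longrightarrow> \<pi> (c\<^sub>1 u) = unit_path a\<^sub>1 b\<^sub>1 \<gamma>\<^sub>1 u"
      "\<And>u. u \<in> {0..1} \<Longrightarrow> \<pi> (c\<^sub>2 u) = unit_path a\<^sub>2 b\<^sub>2 \<gamma>\<^sub>2 u"
    using unit1(5) unit2(5) by (auto simp: is_lift_def)
  have "compact (c\<^sub>1 ` {0..1} \<union> c\<^sub>2 ` {0..1})" "c\<^sub>1 ` {0..1} \<union> c\<^sub>2 ` {0..1} \<subseteq> W"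
    using c_cont c_W by (auto intro!: compact_Un compact_continuous_image)
  then obtain f U where f: "smooth_on f UNIV" "\<And>x. f x \<in> W" "\<And>x. bij (frechet_derivative f (at x))"
    and U: "open U" "c\<^sub>1 ` {0..1} \<union> c\<^sub>2 ` {0..1} \<subseteq> U" "\<And>x. x \<in> U \<Longrightarrow> f x = x"
    using tame_imp_regular_map_fixing_neighbourhood[OF tame] by blast
  have f_deriv: "(f has_derivative frechet_derivative f (at x)) (at x)" for x
    using smooth_on_imp_C1(1)[OF f(1)] by simp
  then have f_lin: "linear (frechet_derivative f (at x))" for x
    using has_derivative_linear by blast
  define k where "k t u = f (S t u)" for t u
  define Y where "Y t u = frechet_derivative f (at (S t u)) (V t u)" for t u
  define \<sigma> where "\<sigma> t u = \<pi> (k t u)" for t u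
  let ?Q = "{0..1::real} \<times> {0..1::real}"
  have f_cont: "continuous_on UNIV f"
    using f_deriv has_derivative_continuous continuous_at_imp_continuous_on by blast
  have k_cont: "continuous_on ?Q (\<lambda>(t, u). k t u)"
    using continuous_on_compose2[OF f_cont S] by (simp add: k_def case_prod_beta)
  have Y_cont: "continuous_on ?Q (\<lambda>(t, u). Y t u)"
  proof -
    have "continuous_on ?Q (\<lambda>z. frechet_derivative f (at ((\<lambda>(t, u). S t u) z)) ((\<lambda>(t, u). V t u) z))"
    proof (rule continuous_on_linear_family_apply[OF f_lin _ V(1)])
      show "continuous_on ?Q (\<lambda>z. frechet_derivative f (at ((\<lambda>(t, u). S t u) z)) v)" for v
        by (rule continuous_on_compose2[OF smooth_on_imp_C1(2)[OF f(1)] S]) simp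
    qed
    then show ?thesis
      by (simp add: Y_def case_prod_beta)
  qed
  have Y_nz: "Y t u \<noteq> 0" if "t \<in> {0..1}" "u \<in> {0..1}" for t u
    using V(2)[OF that] inj_eq[OF bij_is_inj[OF f(3)], of "S t u" "V t u" 0] linear_0[OF f_lin]
    by (simp add: Y_def)
  have k_deriv: "(k t has_vector_derivative Y t u) (at u within {0..1})"
    if "t \<in> {0..1}" "u \<in> {0..1}" for t u
  proof -
    have "((\<lambda>u. f (S t u)) has_derivative (\<lambda>s. frechet_derivative f (at (S t u)) (s *\<^sub>R V t u)))
        (at u within {0..1})"
      using has_derivative_compose[OF V(3)[OF that, unfolded has_vector_derivative_def] f_deriv] .
    then show ?thesis
      by (simp add: has_vector_derivative_def k_def[abs_def] Y_def linear_scale[OF f_lin])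
  qed
  have k_W: "k t u \<in> W" for t u
    by (simp add: k_def f(2))
  have \<sigma>_reg: "regular_curve M A 0 1 (\<sigma> t)" if t: "t \<in> {0..1}" for t
    by (rule regular_curve_project[OF zero_less_one k_W continuous_on_slice[OF Y_cont t] Y_nz[OF t] k_deriv[OF t]])
       (simp_all add: \<sigma>_def)
  have \<sigma>_lift: "is_lift W \<pi> 0 1 (\<sigma> t) (k t)" if t: "t \<in> {0..1}" for t
    using continuous_on_slice[OF k_cont t] k_W by (auto simp: is_lift_def \<sigma>_def)
  have k_vel: "vector_derivative (k t) (at u within {0..1}) = Y t u"
    if "t \<in> {0..1}" "u \<in> {0..1}" for t u
    using vector_derivative_within_closed_interval[OF zero_less_one that(2) k_deriv[OF that]] .
  have f_id: "f (c\<^sub>1 u) = c\<^sub>1 u" "f (c\<^sub>2 u) = c\<^sub>2 u" "frechet_derivative f (at (c\<^sub>1 u)) x = x"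
    if "u \<in> {0..1}" for u x
  proof -
    have "c\<^sub>1 u \<in> U" "c\<^sub>2 u \<in> U"
      using U(2) that by auto
    then show "f (c\<^sub>1 u) = c\<^sub>1 u" "f (c\<^sub>2 u) = c\<^sub>2 u" "frechet_derivative f (at (c\<^sub>1 u)) x = x"
      using U(3) frechet_derivative_eq_id[OF U(1) _ U(3)] by auto
  qed
  \<comment> \<open>near the common end points of all stages \<open>f\<close> is the identity, so it preserves the end velocities\<close>
  have dir_ends: "direction A g 0 1 (\<sigma> t) e = direction A g a\<^sub>1 b\<^sub>1 \<gamma>\<^sub>1 e'"
    if t: "t \<in> {0..1}" and e: "e = 0 \<and> e' = a\<^sub>1 \<or> e = 1 \<and> e' = b\<^sub>1" for t e e'
  proof -
    have e_in: "e \<in> {0..1}" "e' \<in> {a\<^sub>1..b\<^sub>1}"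
      using e lt by auto
    have S_e: "S t e = c\<^sub>1 e"
      using S_ends[OF t] e by auto
    then have k_e: "k t e = \<gamma>\<^sub>1' e'" and Y_e: "Y t e = V t e"
      using f_id[OF e_in(1)] c_ends e by (auto simp: k_def Y_def)
    have "v\<^sub>1 e = (b\<^sub>1 - a\<^sub>1) *\<^sub>R X\<^sub>1 e'"
      using v_ends e by auto
    moreover obtain l where "0 < l" "V t e = l *\<^sub>R v\<^sub>1 e"
      using V_ends[OF t] e by auto
    ultimately have "0 < l * (b\<^sub>1 - a\<^sub>1) \<and> Y t e = (l * (b\<^sub>1 - a\<^sub>1)) *\<^sub>R X\<^sub>1 e'"
      using lt Y_e by simp
    then show ?thesis
      using direction_eq_iff_lift[OF \<sigma>_reg[OF t] reg(1) \<sigma>_lift[OF t] lift(1) e_in k_e]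
        k_vel[OF t e_in(1)] by (auto simp: X\<^sub>1_def)
  qed
  have \<sigma>_ends: "\<sigma> t 0 = \<gamma>\<^sub>1 a\<^sub>1" "\<sigma> t 1 = \<gamma>\<^sub>1 b\<^sub>1" if t: "t \<in> {0..1}" for t
    using S_ends[OF t] f_id(1)[of 0] f_id(1)[of 1] \<pi>_c(1)[of 0] \<pi>_c(1)[of 1]
    by (simp_all add: \<sigma>_def k_def unit_path_def)
  have closed1: "\<gamma>\<^sub>1 a\<^sub>1 = \<gamma>\<^sub>1 b\<^sub>1" "direction A g a\<^sub>1 b\<^sub>1 \<gamma>\<^sub>1 a\<^sub>1 = direction A g a\<^sub>1 b\<^sub>1 \<gamma>\<^sub>1 b\<^sub>1"
    using closed(1) by (simp_all add: regular_closed_curve_def)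
  have "regular_homotopy M A g 0 1 \<sigma>"
    unfolding regular_homotopy_def
  proof (intro conjI ballI)
    have "continuous_on ?Q (\<lambda>z. \<pi> ((\<lambda>(t, u). k t u) z))"
      by (rule continuous_on_compose2[OF covering_space_imp_continuous[OF covering] k_cont])
         (use k_W in auto)
    then show "continuous_on ?Q (\<lambda>(t, u). \<sigma> t u)"
      by (simp add: \<sigma>_def case_prod_beta)
    show "regular_closed_curve M A g 0 1 (\<sigma> t)" if t: "t \<in> {0..1}" for t
      using \<sigma>_reg[OF t] \<sigma>_ends[OF t] dir_ends[OF t, of 0 a\<^sub>1] dir_ends[OF t, of 1 b\<^sub>1] closed1
      by (simp add: regular_closed_curve_def)
    show "continuous_on {(t, u). t \<in> {0..1} \<and> u \<in> {0..1} \<and> \<sigma> t u \<in> fst c}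
        (\<lambda>(t, u). velocity A 0 1 (\<sigma> t) u c)" if "c \<in> A" for c
      by (rule continuous_on_velocity_project[OF zero_less_one k_cont k_W Y_cont k_deriv _ that])
         (simp_all add: \<sigma>_def)
  qed
  moreover have "reparametrization a b \<gamma> 0 1 \<delta>"
    if "a < b" "\<And>u. u \<in> {0..1} \<Longrightarrow> \<delta> u = unit_path a b \<gamma> u" for a b \<gamma> and \<delta> :: "real \<Rightarrow> 'm"
    unfolding reparametrization_def
    by (rule exI[of _ "\<lambda>s. a + s * (b - a)"], rule exI[of _ "\<lambda>_. b - a"])
       (use that affine in \<open>auto simp: unit_path_def\<close>)
  then have "reparametrization a\<^sub>1 b\<^sub>1 \<gamma>\<^sub>1 0 1 (\<sigma> 0)" "reparametrization a\<^sub>2 b\<^sub>2 \<gamma>\<^sub>2 0 1 (\<sigma> 1)"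
    using lt S01 f_id \<pi>_c by (simp_all add: \<sigma>_def k_def)
  moreover have "\<sigma> t 0 = \<gamma>\<^sub>1 a\<^sub>1 \<and> direction A g 0 1 (\<sigma> t) 0 = direction A g a\<^sub>1 b\<^sub>1 \<gamma>\<^sub>1 a\<^sub>1"
    if "t \<in> {0..1}" for t
    using \<sigma>_ends[OF that] dir_ends[OF that, of 0 a\<^sub>1] by simp
  ultimately show ?thesis
    unfolding regularly_homotopic_fixing_base_def by blast
qed

end

theorem theorem3p5:
  fixes M :: "'m::topological_space set" and A :: "'m chart set" and g :: "'m metric_tensor"
    and W :: "complex set" and \<pi> :: "complex \<Rightarrow> 'm"
    and a\<^sub>1 b\<^sub>1 a\<^sub>2 b\<^sub>2 :: real and \<gamma>\<^sub>1 \<gamma>\<^sub>2 :: "real \<Rightarrow> 'm"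
    and p :: 'm and p' :: complex and \<gamma>\<^sub>1' \<gamma>\<^sub>2' :: "real \<Rightarrow> complex"
  assumes "riemannian_surface M A g"
    and "tame M A g W \<pi>"
    and "regular_closed_curve M A g a\<^sub>1 b\<^sub>1 \<gamma>\<^sub>1"
    and "regular_closed_curve M A g a\<^sub>2 b\<^sub>2 \<gamma>\<^sub>2"
    and "\<gamma>\<^sub>1 a\<^sub>1 = p" and "\<gamma>\<^sub>2 a\<^sub>2 = p"
    and "direction A g a\<^sub>1 b\<^sub>1 \<gamma>\<^sub>1 a\<^sub>1 = direction A g a\<^sub>2 b\<^sub>2 \<gamma>\<^sub>2 a\<^sub>2"
    and "p' \<in> W" and "\<pi> p' = p"
    and "is_lift W \<pi> a\<^sub>1 b\<^sub>1 \<gamma>\<^sub>1 \<gamma>\<^sub>1'" and "\<gamma>\<^sub>1' a\<^sub>1 = p'"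
    and "is_lift W \<pi> a\<^sub>2 b\<^sub>2 \<gamma>\<^sub>2 \<gamma>\<^sub>2'" and "\<gamma>\<^sub>2' a\<^sub>2 = p'"
  shows "regularly_homotopic_fixing_base M A g a\<^sub>1 b\<^sub>1 \<gamma>\<^sub>1 a\<^sub>2 b\<^sub>2 \<gamma>\<^sub>2 \<longleftrightarrow>
    homotopic_paths M (unit_path a\<^sub>1 b\<^sub>1 \<gamma>\<^sub>1) (unit_path a\<^sub>2 b\<^sub>2 \<gamma>\<^sub>2) \<and>
    i_index a\<^sub>1 b\<^sub>1 \<gamma>\<^sub>1' = i_index a\<^sub>2 b\<^sub>2 \<gamma>\<^sub>2'"
proof -
  have "covering_space W \<pi> M" "local_diffeo A W \<pi>"
    using assms(2) by (simp_all add: tame_def conformally_euclidean_structure_def)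
  then interpret covered_surface M A g W \<pi>
    using assms(1) by (simp add: covered_surface_def covered_surface_axioms_def)
  have C1: "C1_curve M A a\<^sub>1 b\<^sub>1 \<gamma>\<^sub>1" "C1_curve M A a\<^sub>2 b\<^sub>2 \<gamma>\<^sub>2"
    using assms(3,4) by (simp_all add: regular_closed_curve_def regular_curve_def)
  have start: "\<gamma>\<^sub>1' a\<^sub>1 = \<gamma>\<^sub>2' a\<^sub>2"
    using assms(11,13) by simp
  show ?thesis
    using regular_homotopy_imp_homotopic_paths[OF C1]
      regular_homotopy_imp_i_index_eq[OF assms(3,4,10,12) start]
      regular_homotopy_if_index_eq[OF assms(2-4,7,10,12) start] by blast
qed

end
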